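(* For compositions $\alpha,\beta$ let $f_{\alpha,\beta}$ denote the number of maximal chains from $\alpha$ to $\beta$ in $\mathcal{R}_c$. Then $$f_{\alpha,\beta}=\sum_{\gamma\vDash|\beta|-|\alpha|}C^{\beta}_{\alpha\gamma}\,f_{\varnothing,\gamma}.$$
   Context: Compositions have positive parts; $\varnothing$ is the empty composition and $\gamma\vDash k$ means $\gamma$ is a composition of $k$. Operators: $\mathfrak{d}_i(\alpha)$ subtracts $1$ from the rightmost part of $\alpha$ equal to $i$ (deleting a resulting $0$), or is $0$ if there is no such part; operators send $0$ to $0$; $\mathfrak{v}_{[i-1]}=\mathfrak{d}_1\cdots\mathfrak{d}_{i-1}$ ($\mathfrak{d}_{i-1}$ applied first; $\mathfrak{v}_{[0]}=\mathrm{id}$); $a_i$ appends a part $i$; $u_i=a_i\mathfrak{v}_{[i-1]}$. $\mathcal{R}_c$ is the poset on compositions with cover relation $\alpha\lessdot_r\beta$ iff $\beta=u_i(\alpha)$ for some $i\geq1$; a maximal chain from $\alpha$ to $\beta$ is a sequence $\alpha=\alpha^{(0)}\lessdot_r\cdots\lessdot_r\alpha^{(k)}=\beta$. $\mathbf{NSym}=\mathbb{Q}\langle\mathbf{h}_1,\mathbf{h}_2,\ldots\rangle$, $\mathbf{h}_\alpha=\mathbf{h}_{\alpha_1}\cdots\mathbf{h}_{\alpha_k}$, ribbons $\mathbf{r}_\beta=\sum_{\alpha\succcurlyeq\beta}(-1)^{l(\beta)-l(\alpha)}\mathbf{h}_\alpha$ ($\alpha\succcurlyeq\beta$: parts of $\alpha$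 are sums of adjacent parts of $\beta$). An SRCT of shape $\alpha\vDash m$ is a bijective filling of the reverse composition diagram (row $r$ from the top has $\alpha_r$ left-justified boxes) by $[m]$ with rows decreasing left to right, first column increasing top to bottom, and: for rows $r<s$ and column $c$ with $(s,c+1)$ a box, if $\tau(r,c)>\tau(s,c+1)$ then $(r,c+1)$ is a box with $\tau(r,c+1)>\tau(s,c+1)$. Its descent set is $\{j: j+1 \text{ lies weakly right of } j\}$ and its descent composition is the associated composition of $m$. The noncommutative Schur functions $\mathbf{s}_\alpha$ are defined by $\mathbf{r}_\beta=\sum_\alpha d_{\alpha\beta}\mathbf{s}_\alpha$, $d_{\alpha\beta}$ the number of SRCTs of shape $\alpha$ and descent composition $\beta$; they form a basis. The coefficients $C^\beta_{\alpha\gamma}$ are defined by $\mathbf{s}_\alpha\cdot\mathbf{s}_\gamma=\sum_\beta C^\beta_{\alpha\gamma}\mathbf{s}_\beta$. *)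

theory Defs
  imports Complex_Main
begin

definition is_comp :: "nat list \<Rightarrow> bool" where
  "is_comp \<alpha> \<longleftrightarrow> (\<forall>x\<in>set \<alpha>. 0 < x)"

definition comps :: "nat \<Rightarrow> nat list set" where
  "comps n = {\<alpha>. is_comp \<alpha> \<and> sum_list \<alpha> = n}"

definition psums :: "nat list \<Rightarrow> nat set" where
  "psums \<alpha> = {sum_list (take k \<alpha>) | k. k \<le> length \<alpha>}"

(* d_i : None plays the role of 0 *)
definition dop :: "nat \<Rightarrow> nat list \<Rightarrow> nat list option" where
  "dop i \<alpha> = (if i \<in> set \<alpha> then
     (let k = Max {k. k < length \<alpha> \<and> \<alpha> ! k = i} in
      Some (if i = 1 then take k \<alpha> @ drop (Suc k) \<alpha> else \<alpha>[k := i - 1]))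
   else None)"

definition vop :: "nat \<Rightarrow> nat list \<Rightarrow> nat list option" where
  "vop i \<alpha> = fold (\<lambda>j x. Option.bind x (dop j)) (rev [1..<i]) (Some \<alpha>)"

definition uop :: "nat \<Rightarrow> nat list \<Rightarrow> nat list option" where
  "uop i \<alpha> = map_option (\<lambda>\<gamma>. \<gamma> @ [i]) (vop i \<alpha>)"

definition rcover :: "nat list \<Rightarrow> nat list \<Rightarrow> bool" where
  "rcover \<alpha> \<beta> \<longleftrightarrow> (\<exists>i\<ge>1. uop i \<alpha> = Some \<beta>)"

definition max_chains :: "nat list \<Rightarrow> nat list \<Rightarrow> nat list list set" where
  "max_chains \<alpha> \<beta> = {cs. cs \<noteq> [] \<and> hd cs = \<alpha> \<and> last cs = \<beta> \<and>
       (\<forall>j. Suc j < length cs \<longrightarrow> rcover (cs ! j) (cs ! Suc j))}"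

definition fchains :: "nat list \<Rightarrow> nat list \<Rightarrow> nat" where
  "fchains \<alpha> \<beta> = card (max_chains \<alpha> \<beta>)"

(* An element of NSym = Q<h1,h2,...> is represented by its coefficient function
   in the basis h_alpha (alpha ranging over compositions); the product
   h_alpha h_gamma = h_(alpha gamma) (concatenation) gives: *)
definition nsym_mult :: "(nat list \<Rightarrow> rat) \<Rightarrow> (nat list \<Rightarrow> rat) \<Rightarrow> (nat list \<Rightarrow> rat)" where
  "nsym_mult p q = (\<lambda>w. \<Sum>k\<le>length w. p (take k w) * q (drop k w))"

(* alpha \<succeq> beta: parts of alpha are sums of adjacent parts of beta *)
definition coarsens :: "nat list \<Rightarrow> nat list \<Rightarrow> bool" where
  "coarsens \<alpha> \<beta> \<longleftrightarrow> is_comp \<alpha> \<and> is_comp \<beta> \<and> sum_list \<alpha> = sum_list \<beta> \<and> psums \<alpha> \<subseteq> psums \<beta>"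

definition ribbon :: "nat list \<Rightarrow> (nat list \<Rightarrow> rat)" where
  "ribbon \<beta> = (\<lambda>\<alpha>. if coarsens \<alpha> \<beta> then (-1) ^ (length \<beta> - length \<alpha>) else 0)"

(* cells (r,c), 0-indexed: row r from the top, column c from the left *)
definition cells :: "nat list \<Rightarrow> (nat \<times> nat) set" where
  "cells \<alpha> = {(r, c). r < length \<alpha> \<and> c < \<alpha> ! r}"

definition srct :: "nat list \<Rightarrow> (nat \<times> nat \<Rightarrow> nat) \<Rightarrow> bool" where
  "srct \<alpha> \<tau> \<longleftrightarrow>
     bij_betw \<tau> (cells \<alpha>) {1..sum_list \<alpha>} \<and>
     (\<forall>x. x \<notin> cells \<alpha> \<longrightarrow> \<tau> x = 0) \<and>
     (\<forall>r c. (r, Suc c) \<in> cells \<alpha> \<longrightarrow> \<tau> (r, c) > \<tau> (r, Suc c)) \<and>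
     (\<forall>r s. r < s \<and> s < length \<alpha> \<longrightarrow> \<tau> (r, 0) < \<tau> (s, 0)) \<and>
     (\<forall>r s c. r < s \<and> (s, Suc c) \<in> cells \<alpha> \<and> (r, c) \<in> cells \<alpha> \<and> \<tau> (r, c) > \<tau> (s, Suc c)
        \<longrightarrow> (r, Suc c) \<in> cells \<alpha> \<and> \<tau> (r, Suc c) > \<tau> (s, Suc c))"

definition col_of :: "nat list \<Rightarrow> (nat \<times> nat \<Rightarrow> nat) \<Rightarrow> nat \<Rightarrow> nat" where
  "col_of \<alpha> \<tau> j = snd (THE x. x \<in> cells \<alpha> \<and> \<tau> x = j)"

definition descent_set :: "nat list \<Rightarrow> (nat \<times> nat \<Rightarrow> nat) \<Rightarrow> nat set" where
  "descent_set \<alpha> \<tau> = {j. 1 \<le> j \<and> j < sum_list \<alpha> \<and> col_of \<alpha> \<tau> (Suc j) \<ge> col_of \<alpha> \<tau> j}"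

definition comp_of_set :: "nat \<Rightarrow> nat set \<Rightarrow> nat list" where
  "comp_of_set m D = (THE \<beta>. is_comp \<beta> \<and> sum_list \<beta> = m \<and> psums \<beta> = D \<union> {0, m})"

definition descent_comp :: "nat list \<Rightarrow> (nat \<times> nat \<Rightarrow> nat) \<Rightarrow> nat list" where
  "descent_comp \<alpha> \<tau> = comp_of_set (sum_list \<alpha>) (descent_set \<alpha> \<tau>)"

definition dcoef :: "nat list \<Rightarrow> nat list \<Rightarrow> nat" where
  "dcoef \<alpha> \<beta> = card {\<tau>. srct \<alpha> \<tau> \<and> descent_comp \<alpha> \<tau> = \<beta>}"

definition nc_schur :: "nat list \<Rightarrow> (nat list \<Rightarrow> rat)" where
  "nc_schur = (THE S. (\<forall>\<beta>. is_comp \<beta> \<longrightarrow>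
        ribbon \<beta> = (\<lambda>w. \<Sum>\<alpha>\<in>comps (sum_list \<beta>). of_nat (dcoef \<alpha> \<beta>) * S \<alpha> w)) \<and>
      (\<forall>\<alpha>. \<not> is_comp \<alpha> \<longrightarrow> S \<alpha> = (\<lambda>_. 0)))"

definition lr_coef :: "nat list \<Rightarrow> nat list \<Rightarrow> nat list \<Rightarrow> rat" where
  "lr_coef \<alpha> \<gamma> = (THE c. nsym_mult (nc_schur \<alpha>) (nc_schur \<gamma>) =
        (\<lambda>w. \<Sum>\<beta>\<in>comps (sum_list \<alpha> + sum_list \<gamma>). c \<beta> * nc_schur \<beta> w) \<and>
      (\<forall>\<beta>. \<beta> \<notin> comps (sum_list \<alpha> + sum_list \<gamma>) \<longrightarrow> c \<beta> = 0))"

end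

theory Submission
  imports Defs
begin

text \<open>Let \<open>t\<^sub>k\<close> add a cell in column \<open>k\<close> (counted from 0): \<open>t\<^sub>0\<close> prepends a part 1 and \<open>t\<^sub>k\<close> increments the
  leftmost part \<open>k\<close>. A tableau is the same as a word in the \<open>t\<^sub>k\<close> that builds its shape from the
  empty composition, so $\mathbf{h}_{a_1} \cdots \mathbf{h}_{a_l}$ corresponds to
  \<open>H\<^bsub>a\<^sub>1\<^esub> \<dots> H\<^bsub>a\<^sub>l\<^esub>\<close> applied to the empty composition, where \<open>H\<^sub>a\<close> is the sum of all products of \<open>a\<close>
  operators \<open>t\<^sub>k\<close> with strictly decreasing indices. Consequently the right Pieri rule
  $\mathbf{s}_\alpha \cdot \mathbf{h}_1 = \sum_i \mathbf{s}_{u_i(\alpha)}$ says that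
  \<open>U = \<Sum>\<^sub>i u\<^sub>i\<close> commutes with every \<open>H\<^sub>a\<close>. This follows from
  \<open>[U, t\<^sub>k] = X\<^sub>k - X\<^bsub>k-1\<^esub>\<close>, \<open>X\<^sub>k t\<^sub>k = 0\<close> and \<open>t\<^bsub>k+1\<^esub> X\<^sub>k = 0\<close> for suitable \<open>X\<^sub>k\<close>, by telescoping.
  Iterating the Pieri rule, $\mathbf{s}_\alpha \cdot \mathbf{h}_1^n$ has coefficients $f_{\alpha,\beta}$;
  the theorem compares this with the product of $\mathbf{s}_\alpha$ and
  $\mathbf{h}_1^n = \sum_\gamma f_{\varnothing,\gamma} \mathbf{s}_\gamma$.\<close>

subsection \<open>Operators on compositions and their commutation relations\<close>

text \<open>What ties the Pieri rule to commutation is the starting point: in \<open>h_a h_1\<close>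
  the factor \<open>h_1\<close> acts first, and on the empty composition \<open>H_1\<close> and
  \<open>U\<close> both give [1]. So moving \<open>U\<close> past all strips turns
  \<open>h_a h_1\<close> into \<open>U\<close> applied to the expansion of \<open>h_a\<close>.

  The obstacle is that \<open>U\<close> and the \<open>H_a\<close> are infinite sums. Rows and
  columns are therefore bounded, and the bounded telescoping leaves one boundary term
  \<open>X_N\<close>. It disappears because \<open>X_N\<close> must remove N cells, which a
  composition of size below N does not have.

  The s_\<alpha> are given only implicitly, by a system with tableau counts as coefficients. The
  system is never inverted explicitly: for fixed v the coefficient of \<open>h_v\<close> in
  s_\<alpha> is a function of \<alpha>, the operators act on such functions by transposition, and a
  function on the compositions of n is determined by its pairings with all \<open>h_a\<close>. This
  follows from unitriangularity, with the sum of the column indices of all cells as height.\<close>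

fun inc_first :: "nat \<Rightarrow> nat list \<Rightarrow> nat list option" where
  "inc_first k [] = None"
| "inc_first k (x # xs) =
    (if x = k then Some (Suc k # xs) else map_option ((#) x) (inc_first k xs))"

definition add_cell :: "nat \<Rightarrow> nat list \<Rightarrow> nat list option" where
  "add_cell k \<alpha> = (if k = 0 then Some (1 # \<alpha>) else inc_first k \<alpha>)"

fun dec_last :: "nat \<Rightarrow> nat list \<Rightarrow> nat list option" where
  "dec_last j [] = None"
| "dec_last j (x # xs) = (case dec_last j xs of
      Some ys \<Rightarrow> Some (x # ys)
    | None \<Rightarrow> if x = j then Some (if j = 1 then xs else (j - 1) # xs) else None)"

lemma dec_last_None_iff [simp]: "dec_last j \<alpha> = None \<longleftrightarrow> j \<notin> set \<alpha>"
  by (induction \<alpha>) (auto split: option.splits)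

lemma inc_first_None_iff [simp]: "inc_first k \<alpha> = None \<longleftrightarrow> k \<notin> set \<alpha>"
  by (induction \<alpha>) auto

lemma dec_last_None [simp]: "j \<notin> set \<alpha> \<Longrightarrow> dec_last j \<alpha> = None"
  by simp

lemma inc_first_None [simp]: "k \<notin> set \<alpha> \<Longrightarrow> inc_first k \<alpha> = None"
  by simp

lemma dec_last_append:
  "j \<notin> set zs \<Longrightarrow> dec_last j (ys @ j # zs) = Some (ys @ (if j = 1 then zs else (j - 1) # zs))"
proof (induction ys)
  case Nil
  then have "dec_last j zs = None" by simp
  then show ?case by simp
qed auto

lemma dop_eq: "dop j \<alpha> = dec_last j \<alpha>"
proof (cases "j \<in> set \<alpha>")
  case True
  then obtain ys zs where \<alpha>: "\<alpha> = ys @ j # zs" "j \<notin> set zs"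
    by (meson split_list_last)
  have "Max {k. k < length \<alpha> \<and> \<alpha> ! k = j} = length ys"
  proof (rule Max_eqI)
    show "length ys \<in> {k. k < length \<alpha> \<and> \<alpha> ! k = j}" using \<alpha> by simp
    show "finite {k. k < length \<alpha> \<and> \<alpha> ! k = j}" by simp
    fix y assume y: "y \<in> {k. k < length \<alpha> \<and> \<alpha> ! k = j}"
    show "y \<le> length ys"
    proof (rule ccontr)
      assume "\<not> y \<le> length ys"
      then have "\<alpha> ! y \<in> set zs" using y \<alpha> by (auto simp: nth_append nth_Cons' )
      then show False using y \<alpha> by auto
    qed
  qed
  then show ?thesis using True \<alpha> by (simp add: dop_def dec_last_append list_update_append)
next
  case False then show ?thesis by (metis dop_def dec_last_None_iff)
qed

lemma inc_first_Some_set: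
  "inc_first k \<alpha> = Some \<beta> \<Longrightarrow> j \<noteq> k \<Longrightarrow> j \<noteq> Suc k \<Longrightarrow> j \<in> set \<beta> \<longleftrightarrow> j \<in> set \<alpha>"
  by (induction \<alpha> arbitrary: \<beta>) (auto split: if_splits)

lemma inc_first_Some_Suc: "inc_first k \<alpha> = Some \<beta> \<Longrightarrow> Suc k \<in> set \<beta>"
  by (induction \<alpha> arbitrary: \<beta>) (auto split: if_splits)

lemma dec_last_SomeD: "dec_last j \<alpha> = Some \<beta> \<Longrightarrow> j \<in> set \<alpha>"
  by (metis dec_last_None option.distinct(1))

text \<open>Only for \<open>j = Suc k\<close> does one operator produce a part that the other
  consumes. For \<open>j = k\<close> both want a part \<open>k\<close>, but one takes the leftmost
  and the other the rightmost: either these are different parts, or there is at most one and both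
  orders fail.\<close>

lemma add_cell_dec_last_commute:
  assumes "j \<noteq> Suc k" "j \<noteq> 0"
  shows "Option.bind (add_cell k \<alpha>) (dec_last j) = Option.bind (dec_last j \<alpha>) (add_cell k)"
proof (cases "k = 0")
  case True
  then show ?thesis using assms
    by (auto simp: add_cell_def split: option.splits)
next
  case False
  have "Option.bind (inc_first k \<alpha>) (dec_last j) = Option.bind (dec_last j \<alpha>) (inc_first k)"
  proof (induction \<alpha>)
    case (Cons x xs)
    show ?case
    proof (cases "inc_first k xs")
      case None
      then show ?thesis using Cons assms False
        by (cases "dec_last j xs") (auto split: option.splits)
    next
      case (Some zs)
      note zs = inc_first_Some_set[OF Some]
      show ?thesis using Cons Some assms False zs[of j]
        by (cases "dec_last j xs"; cases "dec_last j zs")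
           (auto split: option.splits dest: dec_last_SomeD)
    qed
  qed simp
  then show ?thesis using False by (simp add: add_cell_def cong: bind_option_cong)
qed

text \<open>When both orders are possible, they either touch different parts or, if the enlarged
  part becomes the rightmost \<open>Suc k\<close>, both return \<open>\<alpha>\<close>. The
  exceptional cases are those in which a part needed by one operator exists only thanks to the
  other.\<close>

lemma dec_last_add_cell:
  "Option.bind (add_cell k \<alpha>) (dec_last (Suc k)) =
    (if Suc k \<in> set \<alpha> then
       (if k = 0 \<or> k \<in> set \<alpha> then Option.bind (dec_last (Suc k) \<alpha>) (add_cell k) else None)
     else (if k = 0 \<or> k \<in> set \<alpha> then Some \<alpha> else None))"
proof (cases "k = 0")
  case True
  then show ?thesis by (auto simp: add_cell_def split: option.splits)
next
  case False
  have "Option.bind (inc_first k \<alpha>) (dec_last (Suc k)) =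
    (if Suc k \<in> set \<alpha> then
       (if k \<in> set \<alpha> then Option.bind (dec_last (Suc k) \<alpha>) (inc_first k) else None)
     else (if k \<in> set \<alpha> then Some \<alpha> else None))"
  proof (induction \<alpha>)
    case (Cons x xs)
    show ?case
      using Cons False
      by (cases "inc_first k xs"; cases "dec_last (Suc k) xs")
         (auto split: option.splits if_splits dest: inc_first_Some_Suc)
  qed simp
  then show ?thesis using False by (simp add: add_cell_def cong: bind_option_cong)
qed

lemma add_cell_dec_last:
  "k \<noteq> 0 \<Longrightarrow> k \<notin> set \<alpha> \<Longrightarrow> Suc k \<in> set \<alpha> \<Longrightarrow>
    Option.bind (dec_last (Suc k) \<alpha>) (add_cell k) = Some \<alpha>"
proof (induction \<alpha>)
  case (Cons x xs)
  show ?case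
  proof (cases "Suc k \<in> set xs")
    case True
    then obtain ys where "dec_last (Suc k) xs = Some ys"
      by (metis dec_last_None_iff option.exhaust)
    then show ?thesis using Cons True by (auto simp: add_cell_def)
  qed (use Cons in \<open>auto simp: add_cell_def\<close>)
qed simp

text \<open>\<open>dec_chain n\<close> is the operator $\mathfrak{v}_{[n]}$.\<close>

fun dec_chain :: "nat \<Rightarrow> nat list \<Rightarrow> nat list option" where
  "dec_chain 0 \<alpha> = Some \<alpha>"
| "dec_chain (Suc n) \<alpha> = Option.bind (dec_last (Suc n) \<alpha>) (dec_chain n)"

lemma vop_Suc: "vop (Suc n) \<alpha> = dec_chain n \<alpha>"
proof -
  have *: "fold (\<lambda>j x. Option.bind x (dop j)) (rev [1..<Suc n]) x = Option.bind x (dec_chain n)" for x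
    by (induction n arbitrary: x) (auto simp: dop_eq bind_assoc split: Option.bind_splits)
  show ?thesis unfolding vop_def * by simp
qed

definition append_row :: "nat \<Rightarrow> nat list \<Rightarrow> nat list option" where
  "append_row n \<alpha> = map_option (\<lambda>\<gamma>. \<gamma> @ [Suc n]) (dec_chain n \<alpha>)"

lemma uop_Suc: "uop (Suc n) = append_row n"
  by (simp add: uop_def append_row_def vop_Suc fun_eq_iff)

text \<open>The commutator of \<open>append_row (Suc k)\<close> with \<open>add_cell k\<close>.\<close>

definition defect :: "nat \<Rightarrow> nat list \<Rightarrow> nat list option" where
  "defect k \<alpha> = (if Suc k \<in> set \<alpha> then None
     else map_option (\<lambda>\<gamma>. \<gamma> @ [Suc (Suc k)]) (dec_chain k \<alpha>))"

lemma dec_last_Some_set: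
  "dec_last j \<alpha> = Some \<beta> \<Longrightarrow> i \<noteq> j \<Longrightarrow> Suc i \<noteq> j \<Longrightarrow> i \<in> set \<beta> \<longleftrightarrow> i \<in> set \<alpha>"
  by (induction \<alpha> arbitrary: \<beta>) (auto split: if_splits option.splits)

lemma dec_last_Some_pred:
  "dec_last (Suc j) \<alpha> = Some \<beta> \<Longrightarrow> j \<noteq> 0 \<Longrightarrow> j \<in> set \<beta>"
  by (induction \<alpha> arbitrary: \<beta>) (auto split: if_splits option.splits)

lemma dec_chain_Some_set:
  "dec_chain n \<alpha> = Some \<beta> \<Longrightarrow> n < i \<Longrightarrow> i \<in> set \<beta> \<longleftrightarrow> i \<in> set \<alpha>"
proof (induction n arbitrary: \<alpha>)
  case (Suc n)
  then obtain \<gamma> where g: "dec_last (Suc n) \<alpha> = Some \<gamma>" "dec_chain n \<gamma> = Some \<beta>"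
    by (auto simp: bind_eq_Some_conv)
  from Suc.IH[OF g(2)] dec_last_Some_set[OF g(1)] Suc.prems(2) show ?case by auto
qed simp

lemma dec_chain_add_cell_ge:
  "n \<le> k \<Longrightarrow> Option.bind (add_cell k \<alpha>) (dec_chain n) = Option.bind (dec_chain n \<alpha>) (add_cell k)"
proof (induction n arbitrary: \<alpha>)
  case (Suc n)
  have "Option.bind (add_cell k \<alpha>) (dec_chain (Suc n)) =
      Option.bind (Option.bind (add_cell k \<alpha>) (dec_last (Suc n))) (dec_chain n)"
    by (simp add: bind_assoc cong: bind_option_cong)
  also have "\<dots> = Option.bind (dec_last (Suc n) \<alpha>) (\<lambda>\<beta>. Option.bind (add_cell k \<beta>) (dec_chain n))"
    using Suc.prems by (simp add: add_cell_dec_last_commute bind_assoc)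
  finally show ?case using Suc by (simp add: bind_assoc cong: bind_option_cong)
qed (simp cong: bind_option_cong)

text \<open>The composite can fail to commute only if its first decrement is the one at
  \<open>Suc k\<close> and no part \<open>Suc k\<close> is present. A longer chain reaches that
  decrement with such a part freshly made by the preceding one.\<close>

lemma dec_chain_add_cell_lt:
  "k < n \<Longrightarrow> Option.bind (add_cell k \<alpha>) (dec_chain n) =
    (if n = Suc k \<and> n \<notin> set \<alpha> then dec_chain k \<alpha> else Option.bind (dec_chain n \<alpha>) (add_cell k))"
proof (induction n arbitrary: \<alpha>)
  case (Suc n)
  have l: "Option.bind (add_cell k \<alpha>) (dec_chain (Suc n)) =
      Option.bind (Option.bind (add_cell k \<alpha>) (dec_last (Suc n))) (dec_chain n)"
    by (simp add: bind_assoc cong: bind_option_cong)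
  show ?case
  proof (cases "k = n")
    case False
    then have kn: "k < n" using Suc.prems by simp
    have "Option.bind (add_cell k \<alpha>) (dec_chain (Suc n)) =
      Option.bind (dec_last (Suc n) \<alpha>) (\<lambda>\<beta>. Option.bind (add_cell k \<beta>) (dec_chain n))"
      unfolding l using False by (simp add: add_cell_dec_last_commute bind_assoc)
    also have "\<dots> = Option.bind (dec_last (Suc n) \<alpha>) (\<lambda>\<beta>. Option.bind (dec_chain n \<beta>) (add_cell k))"
    proof (rule bind_option_cong)
      fix \<beta> assume "\<beta> \<in> set_option (dec_last (Suc n) \<alpha>)"
      \<comment> \<open>Decrementing a part \<open>Suc n\<close> has just left a part
        \<open>n\<close>, which excludes the exceptional case of the induction hypothesis.\<close>
      then have "n \<in> set \<beta>" using dec_last_Some_pred[of n \<alpha> \<beta>] kn by simp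
      then show "Option.bind (add_cell k \<beta>) (dec_chain n) = Option.bind (dec_chain n \<beta>) (add_cell k)"
        using Suc.IH[OF kn, of \<beta>] by simp
    qed simp
    also have "\<dots> = Option.bind (dec_chain (Suc n) \<alpha>) (add_cell k)"
      by (simp add: bind_assoc)
    finally show ?thesis using False by (simp del: dec_chain.simps)
  next
    case kn: True
    show ?thesis
    proof (cases "Suc n \<in> set \<alpha>")
      case in1: True
      show ?thesis
      proof (cases "n = 0 \<or> n \<in> set \<alpha>")
        case True
        then show ?thesis unfolding l unfolding kn using in1
          by (simp add: dec_last_add_cell bind_assoc dec_chain_add_cell_ge)
      next
        case False
        then obtain m where m: "n = Suc m" by (cases n) auto
        \<comment> \<open>Without a part \<open>n\<close> the single step does not commute:
          decrementing and then adding restores \<open>\<alpha>\<close>. The rest of the chain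
          repairs this, since it starts by asking for the missing part \<open>n\<close>.\<close>
        have "Option.bind (dec_chain (Suc n) \<alpha>) (add_cell n) =
            Option.bind (Option.bind (dec_last (Suc n) \<alpha>) (add_cell n)) (dec_chain n)"
          by (simp add: bind_assoc dec_chain_add_cell_ge kn)
        also have "\<dots> = None" using False in1 m by (simp add: add_cell_dec_last)
        finally show ?thesis unfolding l unfolding kn using False in1
          by (simp add: dec_last_add_cell)
      qed
    next
      case False
      have "n \<noteq> 0 \<Longrightarrow> n \<notin> set \<alpha> \<Longrightarrow> dec_chain n \<alpha> = None" by (cases n) auto
      then show ?thesis unfolding l unfolding kn using False by (auto simp: dec_last_add_cell)
    qed
  qed
qed simp

section \<open>Appending a row versus adding a cell\<close>

lemma inc_first_append:
  "inc_first k (\<alpha> @ \<beta>) = (if k \<in> set \<alpha> then map_option (\<lambda>\<gamma>. \<gamma> @ \<beta>) (inc_first k \<alpha>)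
    else map_option (\<lambda>\<gamma>. \<alpha> @ \<gamma>) (inc_first k \<beta>))"
proof (induction \<alpha>)
  case Nil
  have "(@) [] = (id :: nat list \<Rightarrow> nat list)" by auto
  then show ?case by (simp add: option.map_id)
qed (auto simp: option.map_comp comp_def)

lemma add_cell_snoc:
  "n \<noteq> 0 \<Longrightarrow> add_cell k (\<alpha> @ [n]) = (if k = n \<and> n \<notin> set \<alpha> then Some (\<alpha> @ [Suc n])
     else map_option (\<lambda>\<gamma>. \<gamma> @ [n]) (add_cell k \<alpha>))"
  by (auto simp: add_cell_def inc_first_append)

lemma append_row_add_cell_same:
  assumes "n \<noteq> Suc k" "k \<noteq> Suc n"
  shows "Option.bind (add_cell k \<alpha>) (append_row n) = Option.bind (append_row n \<alpha>) (add_cell k)"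
proof -
  have "Option.bind (add_cell k \<alpha>) (append_row n) =
      map_option (\<lambda>\<gamma>. \<gamma> @ [Suc n]) (Option.bind (add_cell k \<alpha>) (dec_chain n))"
    by (cases "add_cell k \<alpha>") (simp_all add: append_row_def[abs_def])
  also have "Option.bind (add_cell k \<alpha>) (dec_chain n) = Option.bind (dec_chain n \<alpha>) (add_cell k)"
    using assms dec_chain_add_cell_ge[of n k \<alpha>] dec_chain_add_cell_lt[of k n \<alpha>]
    by (cases "n \<le> k") auto
  finally show ?thesis using assms
    by (cases "dec_chain n \<alpha>") (simp_all add: append_row_def[abs_def] add_cell_snoc)
qed

text \<open>If \<open>\<alpha>\<close> has no part \<open>Suc k\<close>, the added cell creates the
  only one and the first decrement undoes it at once, so the chain continues from
  \<open>\<alpha>\<close> itself. The opposite order fails.\<close>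

lemma append_row_Suc_add_cell:
  "Option.bind (add_cell k \<alpha>) (append_row (Suc k)) =
    (if Suc k \<in> set \<alpha> then Option.bind (append_row (Suc k) \<alpha>) (add_cell k) else defect k \<alpha>)"
proof -
  have "Option.bind (add_cell k \<alpha>) (append_row (Suc k)) =
      map_option (\<lambda>\<gamma>. \<gamma> @ [Suc (Suc k)]) (Option.bind (add_cell k \<alpha>) (dec_chain (Suc k)))"
    by (cases "add_cell k \<alpha>") (simp_all add: append_row_def[abs_def])
  then show ?thesis
    using dec_chain_add_cell_lt[of k "Suc k" \<alpha>]
    by (cases "dec_chain (Suc k) \<alpha>") (auto simp: append_row_def[abs_def] add_cell_snoc defect_def)
qed

text \<open>If \<open>\<alpha>\<close> has no part \<open>Suc n\<close>, the cell lands in the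
  appended row and lengthens it. The outcome is again \<open>defect n\<close>, but from the other
  order of composition; this is the source of the opposite signs in the telescoping.\<close>

lemma add_cell_Suc_append_row:
  "Option.bind (append_row n \<alpha>) (add_cell (Suc n)) =
    (if Suc n \<in> set \<alpha> then Option.bind (add_cell (Suc n) \<alpha>) (append_row n) else defect n \<alpha>)"
proof -
  have "Option.bind (add_cell (Suc n) \<alpha>) (append_row n) =
      map_option (\<lambda>\<gamma>. \<gamma> @ [Suc n]) (Option.bind (add_cell (Suc n) \<alpha>) (dec_chain n))"
    by (cases "add_cell (Suc n) \<alpha>") (simp_all add: append_row_def[abs_def])
  also have "Option.bind (add_cell (Suc n) \<alpha>) (dec_chain n) = Option.bind (dec_chain n \<alpha>) (add_cell (Suc n))"
    by (simp add: dec_chain_add_cell_ge)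
  finally show ?thesis
    using dec_chain_Some_set[of n \<alpha> _ "Suc n"]
    by (cases "dec_chain n \<alpha>") (auto simp: append_row_def[abs_def] add_cell_snoc defect_def)
qed

lemma add_cell_Some_set: "add_cell k \<alpha> = Some \<beta> \<Longrightarrow> Suc k \<in> set \<beta>"
  by (auto simp: add_cell_def inc_first_Some_Suc split: if_splits)

text \<open>\<open>add_cell k\<close> leaves a part \<open>Suc k\<close>, in whose presence
  \<open>defect k\<close> is undefined.\<close>

lemma defect_add_cell: "Option.bind (add_cell k \<alpha>) (defect k) = None"
  using add_cell_Some_set[of k \<alpha>] by (cases "add_cell k \<alpha>") (auto simp: defect_def)

text \<open>The output of \<open>defect k\<close> offers no part \<open>Suc k\<close> to enlarge:
  \<open>\<alpha>\<close> has none, \<open>dec_chain k\<close> makes none, and the appended row has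
  length k + 2.\<close>

lemma add_cell_defect: "Option.bind (defect k \<alpha>) (add_cell (Suc k)) = None"
proof (cases "Suc k \<in> set \<alpha>")
  case False
  then have "Option.bind (dec_chain k \<alpha>) (add_cell (Suc k)) = None"
    unfolding dec_chain_add_cell_ge[of k "Suc k" \<alpha>, simplified, symmetric]
    by (simp add: add_cell_def)
  then show ?thesis
    by (cases "dec_chain k \<alpha>") (auto simp: defect_def add_cell_snoc)
qed (simp add: defect_def)

subsection \<open>Adding horizontal strips commutes with appending rows\<close>

text \<open>Transpose of a partial operator, acting on functions that stand for linear functionals;
  failure counts as 0. In nested pulls the outermost operator acts first on the composition.\<close>

definition pull :: "(nat list \<Rightarrow> nat list option) \<Rightarrow> (nat list \<Rightarrow> rat) \<Rightarrow> nat list \<Rightarrow> rat" where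
  "pull T f \<alpha> = (case T \<alpha> of None \<Rightarrow> 0 | Some \<beta> \<Rightarrow> f \<beta>)"

lemma pull_pull: "pull T (pull S f) = pull (\<lambda>\<alpha>. Option.bind (T \<alpha>) S) f"
  by (auto simp: pull_def fun_eq_iff split: option.splits Option.bind_splits)

lemma pull_add: "pull T (\<lambda>\<alpha>. f \<alpha> + g \<alpha>) = (\<lambda>\<alpha>. pull T f \<alpha> + pull T g \<alpha>)"
  by (auto simp: pull_def fun_eq_iff split: option.splits)

lemma pull_zero: "pull T (\<lambda>_. 0) = (\<lambda>_. 0)"
  by (auto simp: pull_def fun_eq_iff split: option.splits)

lemma pull_sum: "pull T (\<lambda>\<alpha>. \<Sum>i\<in>I. f i \<alpha>) = (\<lambda>\<alpha>. \<Sum>i\<in>I. pull T (f i) \<alpha>)"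
  by (auto simp: pull_def fun_eq_iff split: option.splits)

text \<open>Bounded version of \<open>U\<close>; on any given composition only finitely many rows
  can be appended, so a large \<open>M\<close> loses nothing.\<close>

definition append_rows :: "nat \<Rightarrow> (nat list \<Rightarrow> rat) \<Rightarrow> nat list \<Rightarrow> rat" where
  "append_rows M f \<alpha> = (\<Sum>n<M. pull (append_row n) f \<alpha>)"

text \<open>\<open>hstrip N k\<close> is dual to the elementary symmetric polynomial of degree \<open>k\<close> in the operators
  \<open>add_cell 0, \<dots>, add_cell (N - 1)\<close>, where in each product smaller columns act first.\<close>

fun hstrip :: "nat \<Rightarrow> nat \<Rightarrow> (nat list \<Rightarrow> rat) \<Rightarrow> nat list \<Rightarrow> rat" where
  "hstrip N 0 f \<alpha> = f \<alpha>"
| "hstrip 0 (Suc k) f \<alpha> = 0"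
| "hstrip (Suc N) (Suc k) f \<alpha> = hstrip N (Suc k) f \<alpha> + hstrip N k (pull (add_cell N) f) \<alpha>"

lemma hstrip_add: "hstrip N k (\<lambda>\<alpha>. f \<alpha> + g \<alpha>) = (\<lambda>\<alpha>. hstrip N k f \<alpha> + hstrip N k g \<alpha>)"
proof (intro ext)
  show "hstrip N k (\<lambda>\<alpha>. f \<alpha> + g \<alpha>) \<alpha> = hstrip N k f \<alpha> + hstrip N k g \<alpha>" for \<alpha>
    by (induction N k f \<alpha> arbitrary: g rule: hstrip.induct) (auto simp: pull_add)
qed

lemma hstrip_zero: "hstrip N k (\<lambda>_. 0) = (\<lambda>_. 0)"
  using hstrip_add[of N k "\<lambda>_. 0" "\<lambda>_. 0"] by (simp add: fun_eq_iff)

lemma hstrip_diff: "hstrip N k (\<lambda>\<alpha>. f \<alpha> - g \<alpha>) = (\<lambda>\<alpha>. hstrip N k f \<alpha> - hstrip N k g \<alpha>)"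
  using hstrip_add[of N k "\<lambda>\<alpha>. f \<alpha> - g \<alpha>" g] by (simp add: fun_eq_iff algebra_simps)

lemma append_rows_add:
  "append_rows M (\<lambda>\<alpha>. f \<alpha> + g \<alpha>) = (\<lambda>\<alpha>. append_rows M f \<alpha> + append_rows M g \<alpha>)"
  by (simp add: append_rows_def pull_add sum.distrib fun_eq_iff)

text \<open>Of all rows only the indices \<open>k + 1\<close> and \<open>k - 1\<close> fail to
  commute with \<open>add_cell k\<close>, with opposite signs. The bound on \<open>M\<close> keeps
  both inside the sum.\<close>

lemma pull_add_cell_append_rows:
  assumes "Suc k < M"
  shows "pull (add_cell k) (append_rows M f) \<alpha> = append_rows M (pull (add_cell k) f) \<alpha>
    + (pull (defect k) f \<alpha> - (if k = 0 then 0 else pull (defect (k - 1)) f \<alpha>))"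
proof -
  have comm: "pull (add_cell k) (pull (append_row n) f) \<alpha> = pull (append_row n) (pull (add_cell k) f) \<alpha>
      + ((if n = Suc k then pull (defect k) f \<alpha> else 0) - (if Suc n = k then pull (defect n) f \<alpha> else 0))"
    for n
  proof -
    consider "n = Suc k" | "k = Suc n" | "n \<noteq> Suc k" "k \<noteq> Suc n" by auto
    then show ?thesis
    proof cases
      case 1
      have "append_row (Suc k) \<alpha> = None" if "Suc k \<notin> set \<alpha>" using that by (simp add: append_row_def)
      then show ?thesis using append_row_Suc_add_cell[of k \<alpha>] 1
        unfolding pull_pull by (auto simp: pull_def defect_def)
    next
      case 2
      have "add_cell (Suc n) \<alpha> = None" if "Suc n \<notin> set \<alpha>" using that by (simp add: add_cell_def)
      then show ?thesis using add_cell_Suc_append_row[of n \<alpha>] 2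
        unfolding pull_pull by (auto simp: pull_def defect_def)
    next
      case 3
      then show ?thesis using append_row_add_cell_same[of n k \<alpha>]
        unfolding pull_pull by (simp add: pull_def)
    qed
  qed
  have "(\<Sum>n<M. if Suc n = k then pull (defect n) f \<alpha> else 0) =
      (if k = 0 then 0 else pull (defect (k - 1)) f \<alpha>)"
    using assms by (cases k) simp_all
  with assms show ?thesis
    by (simp add: append_rows_def[abs_def] pull_sum comm sum.distrib sum_subtractf)
qed

lemma hstrip_append_rows:
  assumes "Suc N < M"
  shows "hstrip (Suc N) (Suc k) (append_rows M f) \<alpha> =
    append_rows M (hstrip (Suc N) (Suc k) f) \<alpha> + hstrip N k (pull (defect N) f) \<alpha>"
  using assms
proof (induction N arbitrary: k f \<alpha>)
  case 0
  have [simp]: "hstrip 0 (Suc k) f = (\<lambda>_. 0)" for k f by (simp add: fun_eq_iff)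
  have [simp]: "append_rows M (\<lambda>_. 0) \<alpha> = 0" by (simp add: append_rows_def pull_zero)
  have *: "pull (add_cell 0) (append_rows M f) = (\<lambda>\<alpha>. append_rows M (pull (add_cell 0) f) \<alpha> + pull (defect 0) f \<alpha>)"
    using 0 by (auto simp: fun_eq_iff pull_add_cell_append_rows)
  have [simp]: "hstrip (Suc 0) (Suc k) f = hstrip 0 k (pull (add_cell 0) f)" for k f by (simp add: fun_eq_iff)
  show ?case by (cases k) (simp_all add: * hstrip_add)
next
  case (Suc N)
  let ?t = "pull (add_cell (Suc N)) f"
  have t: "pull (add_cell (Suc N)) (append_rows M f) =
      (\<lambda>\<alpha>. append_rows M ?t \<alpha> + (pull (defect (Suc N)) f \<alpha> - pull (defect N) f \<alpha>))"
    using Suc.prems by (auto simp: fun_eq_iff pull_add_cell_append_rows)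
  have Xt: "pull (defect N) ?t = (\<lambda>_. 0)"
    by (simp add: pull_pull add_cell_defect) (simp add: pull_def fun_eq_iff)
  have tX: "pull (add_cell N) (pull (defect N) f) = (\<lambda>_. 0)"
    by (simp add: pull_pull defect_add_cell) (simp add: pull_def fun_eq_iff)
  \<comment> \<open>Here the boundary term of the induction hypothesis would put a cell in column
    \<open>Suc N\<close> right after \<open>defect N\<close>, which \<open>Xt\<close>
    forbids.\<close>
  have A: "hstrip (Suc N) k (append_rows M ?t) \<alpha> = append_rows M (hstrip (Suc N) k ?t) \<alpha>"
  proof (cases k)
    case 0
    have "hstrip (Suc N) 0 f = f" for f by (simp add: fun_eq_iff)
    then show ?thesis by (simp add: 0)
  next
    case (Suc k')
    then show ?thesis using Suc.IH[of k' ?t] Suc.prems by (simp add: Xt hstrip_zero del: hstrip.simps)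
  qed
  \<comment> \<open>A strip that uses column \<open>N\<close> would apply \<open>add_cell N\<close>
    immediately before \<open>defect N\<close>, so column \<open>N\<close> may be dropped.\<close>
  have B: "hstrip (Suc N) k (pull (defect N) f) \<alpha> = hstrip N k (pull (defect N) f) \<alpha>"
    by (cases k) (simp_all add: tX hstrip_zero)
  have e: "hstrip (Suc (Suc N)) (Suc k) f = (\<lambda>\<alpha>. hstrip (Suc N) (Suc k) f \<alpha> + hstrip (Suc N) k ?t \<alpha>)"
    by (simp only: hstrip.simps fun_eq_iff) simp
  have "hstrip (Suc (Suc N)) (Suc k) (append_rows M f) \<alpha> =
      hstrip (Suc N) (Suc k) (append_rows M f) \<alpha> + hstrip (Suc N) k (append_rows M ?t) \<alpha>
      + hstrip (Suc N) k (pull (defect (Suc N)) f) \<alpha> - hstrip (Suc N) k (pull (defect N) f) \<alpha>"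
    by (simp only: hstrip.simps(3)[of "Suc N"] t hstrip_add hstrip_diff add_diff_eq add.assoc)
  also have "\<dots> = append_rows M (hstrip (Suc N) (Suc k) f) \<alpha> + append_rows M (hstrip (Suc N) k ?t) \<alpha>
      + hstrip (Suc N) k (pull (defect (Suc N)) f) \<alpha>"
    using Suc.IH[of k f] Suc.prems by (simp add: A B del: hstrip.simps)
  finally show ?case unfolding e append_rows_add .
qed

subsection \<open>Standard reverse composition tableaux as words\<close>

fun add_cells :: "nat list \<Rightarrow> nat list \<Rightarrow> nat list option" where
  "add_cells [] \<alpha> = Some \<alpha>"
| "add_cells (c # w) \<alpha> = Option.bind (add_cells w \<alpha>) (add_cell c)"

lemma add_cells_append: "add_cells (u @ v) \<alpha> = Option.bind (add_cells v \<alpha>) (add_cells u)"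
  by (induction u) (auto simp: bind_assoc cong: bind_option_cong)

lemma inc_first_eq_Some_iff:
  "inc_first k \<alpha> = Some \<beta> \<longleftrightarrow>
    (\<exists>r<length \<alpha>. \<alpha> ! r = k \<and> (\<forall>r'<r. \<alpha> ! r' \<noteq> k) \<and> \<beta> = \<alpha>[r := Suc k])"
  by (induction \<alpha> arbitrary: \<beta>) (auto simp: Ex_less_Suc2 All_less_Suc2)

lemma is_comp_Nil [simp]: "is_comp []" by (simp add: is_comp_def)

lemma is_comp_Cons [simp]: "is_comp (x # xs) \<longleftrightarrow> 0 < x \<and> is_comp xs"
  by (auto simp: is_comp_def)

lemma is_comp_append [simp]: "is_comp (xs @ ys) \<longleftrightarrow> is_comp xs \<and> is_comp ys"
  by (auto simp: is_comp_def)

lemma is_comp_nth: "is_comp \<alpha> \<Longrightarrow> i < length \<alpha> \<Longrightarrow> 0 < \<alpha> ! i"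
  by (simp add: is_comp_def)

lemma inc_first_Some_comp:
  "inc_first k \<alpha> = Some \<beta> \<Longrightarrow> sum_list \<beta> = Suc (sum_list \<alpha>) \<and> (is_comp \<alpha> \<longrightarrow> is_comp \<beta>)"
  by (induction \<alpha> arbitrary: \<beta>) (auto split: if_splits)

lemma add_cell_Some_comp:
  "add_cell k \<alpha> = Some \<beta> \<Longrightarrow> sum_list \<beta> = Suc (sum_list \<alpha>) \<and> (is_comp \<alpha> \<longrightarrow> is_comp \<beta>)"
  by (auto simp: add_cell_def dest: inc_first_Some_comp split: if_splits)

lemma add_cells_Some_comp:
  "add_cells w \<alpha> = Some \<beta> \<Longrightarrow>
    sum_list \<beta> = sum_list \<alpha> + length w \<and> (is_comp \<alpha> \<longrightarrow> is_comp \<beta>)"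
  by (induction w arbitrary: \<beta>) (auto simp: bind_eq_Some_conv dest!: add_cell_Some_comp)

text \<open>Isolates the renumbering when a new least entry is inserted. The equivalence serves both
  insertion and removal.\<close>

lemma bij_betw_insert_first:
  assumes "inj_on \<phi> A" "p \<notin> \<phi> ` A" "g p = (1::nat)"
    and "\<And>y. y \<in> A \<Longrightarrow> g (\<phi> y) = Suc (h y)"
  shows "bij_betw g (insert p (\<phi> ` A)) {1..Suc n} \<longleftrightarrow> bij_betw h A {1..n}"
proof -
  have img: "g ` \<phi> ` A = Suc ` h ` A"
    unfolding image_image using assms(4) by (intro image_cong) auto
  have "inj_on g (\<phi> ` A) \<longleftrightarrow> inj_on (g \<circ> \<phi>) A" by (rule comp_inj_on_iff[OF assms(1)])
  also have "\<dots> \<longleftrightarrow> inj_on (Suc \<circ> h) A" using assms(4) by (intro inj_on_cong) simp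
  also have "\<dots> \<longleftrightarrow> inj_on h A" by (meson comp_inj_on_iff inj_on_imageI2 inj_Suc comp_inj_on subset_UNIV inj_on_subset)
  finally have inj: "inj_on g (\<phi> ` A) \<longleftrightarrow> inj_on h A" .
  have S: "{1..Suc n} = insert 1 (Suc ` {1..n})"
    using atLeastAtMost_insertL[of 1 "Suc n"] by (simp add: image_Suc_atLeastAtMost)
  show ?thesis
  proof
    assume b: "bij_betw g (insert p (\<phi> ` A)) {1..Suc n}"
    then have i: "inj_on g (insert p (\<phi> ` A))" and e: "insert 1 (Suc ` h ` A) = insert 1 (Suc ` {1..n})"
      using assms(3) img S by (auto simp: bij_betw_def)
    have "g p \<notin> g ` \<phi> ` A" using i assms(2) by (auto simp: inj_on_insert)
    then have "1 \<notin> Suc ` h ` A" by (simp only: assms(3) img not_False_eq_True)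
    moreover have "1 \<notin> Suc ` {1..n}" by auto
    ultimately have "Suc ` h ` A = Suc ` {1..n}" using e insert_ident by metis
    then have "h ` A = {1..n}" by (simp only: inj_image_eq_iff[OF inj_Suc])
    then show "bij_betw h A {1..n}" using i inj by (auto simp: bij_betw_def)
  next
    assume b: "bij_betw h A {1..n}"
    then have "g ` insert p (\<phi> ` A) = {1..Suc n}" unfolding S by (simp add: img assms(3) bij_betw_def)
    moreover have "inj_on g (insert p (\<phi> ` A))"
    proof -
      have "0 \<notin> h ` A" using b by (simp add: bij_betw_def)
      then have "1 \<notin> g ` \<phi> ` A" unfolding img by auto
      then show ?thesis using b inj assms(2,3) by (simp add: bij_betw_def)
    qed
    ultimately show "bij_betw g (insert p (\<phi> ` A)) {1..Suc n}" by (simp add: bij_betw_def)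
  qed
qed

section \<open>Inserting and removing the least entry of a tableau\<close>

text \<open>The \<open>LEAST\<close> also ranges over indices beyond the length, where
  \<open>\<alpha> ! r\<close> is unspecified. This is harmless whenever
  \<open>add_cell k \<alpha>\<close> succeeds, since then a row of length \<open>k\<close> occurs at
  a proper index.\<close>

definition new_cell :: "nat \<Rightarrow> nat list \<Rightarrow> nat \<times> nat" where
  "new_cell k \<alpha> = (if k = 0 then 0 else LEAST r. \<alpha> ! r = k, k)"

definition old_cell :: "nat \<Rightarrow> nat \<times> nat \<Rightarrow> nat \<times> nat" where
  "old_cell k = (\<lambda>(r, c). (if k = 0 then Suc r else r, c))"

definition extend_tab :: "nat \<Rightarrow> nat list \<Rightarrow> (nat \<times> nat \<Rightarrow> nat) \<Rightarrow> nat \<times> nat \<Rightarrow> nat" where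
  "extend_tab k \<alpha> \<tau> x = (if x = new_cell k \<alpha> then 1
     else if x \<in> old_cell k ` cells \<alpha> then Suc (\<tau> (inv (old_cell k) x)) else 0)"

text \<open>The letters of a word are columns and its last letter acts first, so its first letter is the
  column of the entry 1.\<close>

fun tab_of_word :: "nat list \<Rightarrow> nat \<times> nat \<Rightarrow> nat" where
  "tab_of_word [] = (\<lambda>_. 0)"
| "tab_of_word (c # w) = extend_tab c (the (add_cells w [])) (tab_of_word w)"

lemma inj_old_cell: "inj (old_cell k)"
  by (auto simp: inj_def old_cell_def)

lemma cells_list_update:
  "r < length \<alpha> \<Longrightarrow> \<alpha> ! r = k \<Longrightarrow> cells (\<alpha>[r := Suc k]) = insert (r, k) (cells \<alpha>)"
  by (auto simp: cells_def nth_list_update split: if_splits)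

lemma cells_Cons: "cells (x # \<alpha>) = {(0, c) | c. c < x} \<union> old_cell 0 ` cells \<alpha>"
proof -
  have "(r, c) \<in> cells (x # \<alpha>) \<longleftrightarrow> (r, c) \<in> {(0, c) | c. c < x} \<union> old_cell 0 ` cells \<alpha>" for r c
    by (cases r) (auto simp: cells_def old_cell_def image_iff)
  then show ?thesis by auto
qed

lemma add_cell_cells:
  assumes "add_cell k \<alpha> = Some \<beta>"
  shows "cells \<beta> = insert (new_cell k \<alpha>) (old_cell k ` cells \<alpha>)" "new_cell k \<alpha> \<notin> old_cell k ` cells \<alpha>"
proof -
  have "cells \<beta> = insert (new_cell k \<alpha>) (old_cell k ` cells \<alpha>) \<and> new_cell k \<alpha> \<notin> old_cell k ` cells \<alpha>"
  proof (cases "k = 0")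
    case True
    then show ?thesis using assms
      by (auto simp: add_cell_def new_cell_def cells_Cons) (auto simp: old_cell_def)
  next
    case False
    then obtain r where r: "r < length \<alpha>" "\<alpha> ! r = k" "\<forall>r'<r. \<alpha> ! r' \<noteq> k" "\<beta> = \<alpha>[r := Suc k]"
      using assms by (auto simp: add_cell_def inc_first_eq_Some_iff)
    have "(LEAST r. \<alpha> ! r = k) = r" using r by (intro Least_equality) (auto simp: not_less[symmetric])
    then have "new_cell k \<alpha> = (r, k)" using False by (simp add: new_cell_def)
    moreover have "old_cell k = id" using False by (auto simp: old_cell_def)
    moreover have "cells \<beta> = insert (r, k) (cells \<alpha>)" using r(1,2) unfolding r(4) by (rule cells_list_update)
    moreover have "(r, k) \<notin> cells \<alpha>" using r(2) by (simp add: cells_def)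
    ultimately show ?thesis by simp
  qed
  then show "cells \<beta> = insert (new_cell k \<alpha>) (old_cell k ` cells \<alpha>)" "new_cell k \<alpha> \<notin> old_cell k ` cells \<alpha>"
    by blast+
qed

lemma extend_tab_old: "add_cell k \<alpha> = Some \<beta> \<Longrightarrow> x \<in> cells \<alpha> \<Longrightarrow> extend_tab k \<alpha> \<tau> (old_cell k x) = Suc (\<tau> x)"
  unfolding extend_tab_def by (metis add_cell_cells(2) image_eqI inv_f_f[OF inj_old_cell])

lemma extend_tab_new: "extend_tab k \<alpha> \<tau> (new_cell k \<alpha>) = 1"
  by (simp add: extend_tab_def)

lemma bij_extend_tab:
  assumes "add_cell k \<alpha> = Some \<beta>"
  shows "bij_betw (extend_tab k \<alpha> \<tau>) (cells \<beta>) {1..Suc n} \<longleftrightarrow> bij_betw \<tau> (cells \<alpha>) {1..n}"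
  unfolding add_cell_cells(1)[OF assms]
  by (rule bij_betw_insert_first[OF inj_on_subset[OF inj_old_cell subset_UNIV]
        add_cell_cells(2)[OF assms] extend_tab_new extend_tab_old[OF assms]])

lemma srct_bij: "srct \<alpha> \<tau> \<Longrightarrow> bij_betw \<tau> (cells \<alpha>) {1..sum_list \<alpha>}"
  by (simp only: srct_def)

lemma srct_pos: "srct \<alpha> \<tau> \<Longrightarrow> x \<in> cells \<alpha> \<Longrightarrow> 0 < \<tau> x"
  using bij_betw_apply[OF srct_bij, of \<alpha> \<tau> x] by simp

lemma srct_row: "srct \<alpha> \<tau> \<Longrightarrow> (r, Suc c) \<in> cells \<alpha> \<Longrightarrow> \<tau> (r, Suc c) < \<tau> (r, c)"
  unfolding srct_def by blast

lemma srct_col: "srct \<alpha> \<tau> \<Longrightarrow> r < s \<Longrightarrow> s < length \<alpha> \<Longrightarrow> \<tau> (r, 0) < \<tau> (s, 0)"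
  unfolding srct_def by blast

lemma srct_triple:
  "srct \<alpha> \<tau> \<Longrightarrow> r < s \<Longrightarrow> (s, Suc c) \<in> cells \<alpha> \<Longrightarrow> (r, c) \<in> cells \<alpha> \<Longrightarrow> \<tau> (s, Suc c) < \<tau> (r, c) \<Longrightarrow>
    (r, Suc c) \<in> cells \<alpha> \<and> \<tau> (s, Suc c) < \<tau> (r, Suc c)"
  unfolding srct_def by blast

lemma srct_outside: "srct \<alpha> \<tau> \<Longrightarrow> x \<notin> cells \<alpha> \<Longrightarrow> \<tau> x = 0"
  unfolding srct_def by blast

lemma cells_Suc: "(r, Suc c) \<in> cells \<alpha> \<Longrightarrow> (r, c) \<in> cells \<alpha>"
  by (auto simp: cells_def)

text \<open>The new entry is the least, so the triple condition is at risk only when the new cell is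
  its lower right corner. A higher row that reaches column \<open>k - 1\<close> does not have length
  exactly \<open>k\<close>, because the first such row was enlarged; hence it also reaches column
  \<open>k\<close>.\<close>

lemma srct_extend_tab:
  assumes "add_cell k \<alpha> = Some \<beta>" "srct \<alpha> \<tau>" "is_comp \<alpha>"
  shows "srct \<beta> (extend_tab k \<alpha> \<tau>)"
proof -
  let ?g = "extend_tab k \<alpha> \<tau>"
  have bij: "bij_betw ?g (cells \<beta>) {1..sum_list \<beta>}"
    using srct_bij[OF assms(2)] add_cell_Some_comp[OF assms(1)] bij_extend_tab[OF assms(1), of \<tau> "sum_list \<alpha>"]
    by simp
  have out: "?g x = 0" if "x \<notin> cells \<beta>" for x
    using that unfolding add_cell_cells(1)[OF assms(1)] by (auto simp: extend_tab_def)
  note pos = srct_pos[OF assms(2)]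
  show ?thesis
  proof (cases "k = 0")
    case True
    then have \<beta>: "\<beta> = 1 # \<alpha>" using assms(1) by (simp add: add_cell_def)
    have g0: "?g (0, 0) = 1" by (simp add: extend_tab_def new_cell_def True)
    have gS: "?g (Suc r, c) = (if (r, c) \<in> cells \<alpha> then Suc (\<tau> (r, c)) else 0)" for r c
      using extend_tab_old[OF assms(1), of "(r, c)" \<tau>] out[of "(Suc r, c)"]
      by (auto simp: old_cell_def True) (auto simp: \<beta> cells_def)
    have cS: "(Suc r, c) \<in> cells \<beta> \<longleftrightarrow> (r, c) \<in> cells \<alpha>" for r c by (auto simp: \<beta> cells_def)
    have c0: "(0, c) \<in> cells \<beta> \<longleftrightarrow> c = 0" for c by (auto simp: \<beta> cells_def)
    have col: "(r, 0) \<in> cells \<alpha>" if "r < length \<alpha>" for r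
      using that is_comp_nth[OF assms(3)] by (simp add: cells_def)
    have R: "?g (r, c) > ?g (r, Suc c)" if "(r, Suc c) \<in> cells \<beta>" for r c
      using that by (cases r) (auto simp: gS cS c0 cells_Suc srct_row[OF assms(2)])
    have C: "?g (r, 0) < ?g (t, 0)" if "r < t" "t < length \<beta>" for r t
      using that by (cases r; cases t) (auto simp: gS g0 \<beta> col pos srct_col[OF assms(2)])
    have T: "(r, Suc c) \<in> cells \<beta> \<and> ?g (r, Suc c) > ?g (t, Suc c)"
      if "r < t" "(t, Suc c) \<in> cells \<beta>" "(r, c) \<in> cells \<beta>" "?g (r, c) > ?g (t, Suc c)" for r t c
      using that srct_triple[OF assms(2), of "r - 1" "t - 1" c]
      by (cases r; cases t) (auto simp: gS cS c0 g0)
    show ?thesis unfolding srct_def using bij out R C T by blast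
  next
    case False
    then obtain r0 where r0: "r0 < length \<alpha>" "\<alpha> ! r0 = k" "\<forall>r'<r0. \<alpha> ! r' \<noteq> k" "\<beta> = \<alpha>[r0 := Suc k]"
      using assms by (auto simp: add_cell_def inc_first_eq_Some_iff)
    have "(LEAST r. \<alpha> ! r = k) = r0" using r0 by (intro Least_equality) (auto simp: not_less[symmetric])
    then have new: "new_cell k \<alpha> = (r0, k)" using False by (simp add: new_cell_def)
    have old: "old_cell k = id" using False by (auto simp: old_cell_def)
    have cb: "x \<in> cells \<beta> \<longleftrightarrow> x = (r0, k) \<or> x \<in> cells \<alpha>" for x
      using add_cell_cells(1)[OF assms(1)] by (simp add: new old)
    have n: "(r0, k) \<notin> cells \<alpha>" using r0 by (simp add: cells_def)
    have g: "?g x = (if x = (r0, k) then 1 else if x \<in> cells \<alpha> then Suc (\<tau> x) else 0)" for x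
      by (simp add: extend_tab_def new old)
    have col: "(r, 0) \<in> cells \<alpha>" if "r < length \<alpha>" for r
      using that is_comp_nth[OF assms(3)] by (simp add: cells_def)
    have last: "(r0, c) \<in> cells \<alpha>" if "Suc c = k" for c using that r0 by (auto simp: cells_def)
    have above: "(r, k) \<in> cells \<alpha>" if "(r, c) \<in> cells \<alpha>" "Suc c = k" "r < r0" for r c
      using that r0 by (auto simp: cells_def)
    have R: "?g (r, c) > ?g (r, Suc c)" if "(r, Suc c) \<in> cells \<beta>" for r c
      using that n last[of c] srct_row[OF assms(2), of r c] cells_Suc[of r c \<alpha>] pos[of "(r, c)"]
      by (auto simp: g cb)
    have C: "?g (r, 0) < ?g (t, 0)" if "r < t" "t < length \<beta>" for r t
      using that col[of r] col[of t] srct_col[OF assms(2), of r t] r0(4) False by (auto simp: g)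
    have T: "(r, Suc c) \<in> cells \<beta> \<and> ?g (r, Suc c) > ?g (t, Suc c)"
      if "r < t" "(t, Suc c) \<in> cells \<beta>" "(r, c) \<in> cells \<beta>" "?g (r, c) > ?g (t, Suc c)" for r t c
    proof (cases "(t, Suc c) = (r0, k)")
      case True
      then have "(r, k) \<in> cells \<alpha>" using above[of r c] that cb False by auto
      then show ?thesis using True that(1) pos[of "(r, k)"] by (auto simp: g cb)
    next
      case False
      then have t: "(t, Suc c) \<in> cells \<alpha>" using that(2) unfolding cb by blast
      then have "(r, c) \<noteq> (r0, k)" using that(4) g False by auto
      then have "(r, c) \<in> cells \<alpha>" "\<tau> (r, c) > \<tau> (t, Suc c)" using that t False by (auto simp: cb g)
      then have "(r, Suc c) \<in> cells \<alpha> \<and> \<tau> (r, Suc c) > \<tau> (t, Suc c)" using srct_triple[OF assms(2) that(1) t] by blast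
      then show ?thesis using n t False by (auto simp: g cb)
    qed
    show ?thesis unfolding srct_def using bij out R C T by blast
  qed
qed

text \<open>The entry 1 ends its row because rows decrease. In column 0 it must head the first row,
  as the first column increases. In column \<open>k > 0\<close> no higher row has length
  \<open>k\<close>: its last entry would exceed 1, and the triple condition would force one more
  cell in that row. So the cell of 1 is exactly the one that \<open>add_cell k\<close> adds.\<close>

lemma srct_remove_first:
  assumes "srct \<beta> \<tau>" "is_comp \<beta>" "\<beta> \<noteq> []"
  obtains k \<alpha> \<tau>' where "is_comp \<alpha>" "add_cell k \<alpha> = Some \<beta>" "srct \<alpha> \<tau>'" "\<tau> = extend_tab k \<alpha> \<tau>'"
proof -
  note pos = srct_pos[OF assms(1)]
  have bij: "bij_betw \<tau> (cells \<beta>) {1..sum_list \<beta>}" using assms(1) by (rule srct_bij)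
  have "0 < sum_list \<beta>" using assms(2,3) by (cases \<beta>) auto
  then obtain r0 k where p: "(r0, k) \<in> cells \<beta>" "\<tau> (r0, k) = 1"
    using bij by (force simp: bij_betw_def)
  have one: "x = (r0, k)" if "x \<in> cells \<beta>" "\<tau> x = 1" for x
    using bij that p by (auto simp: bij_betw_def inj_on_def)
  have "(r0, Suc k) \<notin> cells \<beta>"
    using srct_row[OF assms(1), of r0 k] pos[of "(r0, Suc k)"] p by auto
  then have len: "r0 < length \<beta>" "\<beta> ! r0 = Suc k" using p by (auto simp: cells_def)
  have id: "\<beta>[r0 := Suc k] = \<beta>" using list_update_id[of \<beta> r0] len(2) by simp
  obtain \<alpha> where \<alpha>: "is_comp \<alpha>" "add_cell k \<alpha> = Some \<beta>" "new_cell k \<alpha> = (r0, k)"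
  proof (cases k)
    case 0
    have "(0, 0) \<in> cells \<beta>" using assms(2,3) is_comp_nth[of \<beta> 0] by (simp add: cells_def)
    then have "r0 = 0" using srct_col[OF assms(1), of 0 r0] p 0 len pos[of "(0, 0)"] by (cases r0) auto
    then show ?thesis using that[of "tl \<beta>"] assms(2) len 0 by (cases \<beta>) (auto simp: add_cell_def new_cell_def)
  next
    case (Suc k')
    have first: "\<beta> ! r \<noteq> k" if "r < r0" for r
    proof
      assume a: "\<beta> ! r = k"
      then have c: "(r, k') \<in> cells \<beta>" using that len Suc by (simp add: cells_def)
      have "\<tau> (r, k') \<noteq> 1" using one[OF c] that by auto
      then have "\<tau> (r, k') > 1" using pos[OF c] by simp
      then have "(r, Suc k') \<in> cells \<beta>" using srct_triple[OF assms(1) that _ c] p Suc by auto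
      then show False using a Suc by (simp add: cells_def)
    qed
    show ?thesis
    proof (rule that)
      show "is_comp (\<beta>[r0 := k])" using assms(2) Suc set_update_subset_insert[of \<beta> r0 k]
        by (auto simp: is_comp_def)
      show "add_cell k (\<beta>[r0 := k]) = Some \<beta>" using Suc first len id
        by (auto simp: add_cell_def inc_first_eq_Some_iff nth_list_update intro!: exI[of _ r0])
      have "(LEAST r. \<beta>[r0 := k] ! r = k) = r0"
        using first len by (intro Least_equality) (auto simp: nth_list_update not_less[symmetric])
      then show "new_cell k (\<beta>[r0 := k]) = (r0, k)" using Suc by (simp add: new_cell_def)
    qed
  qed
  define \<tau>' where "\<tau>' y = \<tau> (old_cell k y) - 1" for y
  note cb = add_cell_cells(1)[OF \<alpha>(2)]
  have old: "old_cell k y \<in> cells \<beta>" if "y \<in> cells \<alpha>" for y using that unfolding cb by blast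
  have val: "\<tau> (old_cell k y) = Suc (\<tau>' y)" if "y \<in> cells \<alpha>" for y
    using pos[OF old[OF that]] by (simp add: \<tau>'_def)
  have ext: "\<tau> x = extend_tab k \<alpha> \<tau>' x" for x
  proof -
    consider "x = new_cell k \<alpha>" | y where "y \<in> cells \<alpha>" "x = old_cell k y" | "x \<notin> cells \<beta>"
      unfolding cb by blast
    then show ?thesis
    proof cases
      case 1 then show ?thesis using p \<alpha>(3) extend_tab_new[of k \<alpha> \<tau>'] by simp
    next
      case 2 then show ?thesis using val by (simp add: extend_tab_old[OF \<alpha>(2)])
    next
      case 3
      then have "extend_tab k \<alpha> \<tau>' x = 0" unfolding cb by (auto simp: extend_tab_def)
      then show ?thesis using srct_outside[OF assms(1) 3] by simp
    qed
  qed
  have pre: "y \<in> cells \<alpha>" if "old_cell k y \<in> cells \<beta>" "\<tau> (old_cell k y) \<noteq> 1" for y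
    using that p \<alpha>(3) unfolding cb by (auto dest: injD[OF inj_old_cell])
  define f where "f r = (if k = 0 then Suc r else r)" for r
  have f: "old_cell k (r, c) = (f r, c)" for r c by (simp add: old_cell_def f_def)
  \<comment> \<open>Truncated subtraction covers two cases: a value 0 outside the diagram stays 0,
    and the removed cell with value 1 drops to 0.\<close>
  have out: "\<tau>' y = 0" if "y \<notin> cells \<alpha>" for y
    using pre[of y] that srct_outside[OF assms(1), of "old_cell k y"]
    by (cases "old_cell k y \<in> cells \<beta>"; cases "\<tau> (old_cell k y) = 1") (auto simp: \<tau>'_def)
  have "bij_betw (extend_tab k \<alpha> \<tau>') (cells \<beta>) {1..Suc (sum_list \<alpha>)}"
    using bij add_cell_Some_comp[OF \<alpha>(2)] unfolding ext[abs_def] by simp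
  then have bij': "bij_betw \<tau>' (cells \<alpha>) {1..sum_list \<alpha>}" by (simp only: bij_extend_tab[OF \<alpha>(2)])
  have flen: "f r < length \<beta>" if "r < length \<alpha>" for r
    using old[of "(r, 0)"] that is_comp_nth[OF \<alpha>(1)] by (auto simp: cells_def f)
  have R: "\<tau>' (r, Suc c) < \<tau>' (r, c)" if "(r, Suc c) \<in> cells \<alpha>" for r c
    using val[OF that] val[OF cells_Suc[OF that]] srct_row[OF assms(1), of "f r" c] old[OF that] by (simp add: f)
  have C: "\<tau>' (r, 0) < \<tau>' (s, 0)" if "r < s" "s < length \<alpha>" for r s
  proof -
    have "(r, 0) \<in> cells \<alpha>" "(s, 0) \<in> cells \<alpha>" using that is_comp_nth[OF \<alpha>(1)] by (auto simp: cells_def)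
    moreover have "\<tau> (f r, 0) < \<tau> (f s, 0)"
      using srct_col[OF assms(1), of "f r" "f s"] flen that by (auto simp: f_def split: if_splits)
    ultimately show ?thesis using val[of "(r, 0)"] val[of "(s, 0)"] by (simp add: f)
  qed
  have T: "(r, Suc c) \<in> cells \<alpha> \<and> \<tau>' (s, Suc c) < \<tau>' (r, Suc c)"
    if "r < s" "(s, Suc c) \<in> cells \<alpha>" "(r, c) \<in> cells \<alpha>" "\<tau>' (s, Suc c) < \<tau>' (r, c)" for r s c
  proof -
    have "(f r, Suc c) \<in> cells \<beta> \<and> \<tau> (f s, Suc c) < \<tau> (f r, Suc c)"
      using srct_triple[OF assms(1), of "f r" "f s" c] old[OF that(2)] old[OF that(3)] that
        val[OF that(2)] val[OF that(3)] by (auto simp: f) (auto simp: f_def)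
    then show ?thesis using pre[of "(r, Suc c)"] val[OF that(2)] val[of "(r, Suc c)"] by (auto simp: f)
  qed
  have "srct \<alpha> \<tau>'" unfolding srct_def using bij' out R C T by blast
  then show ?thesis using that[OF \<alpha>(1,2)] ext by blast
qed

section \<open>Tableaux and their column words\<close>

lemma col_of_eq: "srct \<alpha> \<tau> \<Longrightarrow> x \<in> cells \<alpha> \<Longrightarrow> col_of \<alpha> \<tau> (\<tau> x) = snd x"
proof -
  assume "srct \<alpha> \<tau>" "x \<in> cells \<alpha>"
  then have "(THE y. y \<in> cells \<alpha> \<and> \<tau> y = \<tau> x) = x"
    by (intro the_equality) (auto dest: srct_bij simp: bij_betw_def inj_on_def)
  then show ?thesis by (simp add: col_of_def)
qed

text \<open>Recovers the word from its tableau, which gives the injectivity of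
  \<open>tab_of_word\<close> on words building \<open>\<alpha>\<close>.\<close>

definition col_word :: "nat list \<Rightarrow> (nat \<times> nat \<Rightarrow> nat) \<Rightarrow> nat list" where
  "col_word \<alpha> \<tau> = map (col_of \<alpha> \<tau>) [1..<Suc (sum_list \<alpha>)]"

lemma col_word_extend_tab:
  assumes "add_cell k \<alpha> = Some \<beta>" "srct \<alpha> \<tau>" "is_comp \<alpha>"
  shows "col_word \<beta> (extend_tab k \<alpha> \<tau>) = k # col_word \<alpha> \<tau>"
proof -
  let ?g = "extend_tab k \<alpha> \<tau>"
  note s = srct_extend_tab[OF assms] and cb = add_cell_cells(1)[OF assms(1)]
  have "col_of \<beta> ?g (?g (new_cell k \<alpha>)) = snd (new_cell k \<alpha>)" by (rule col_of_eq[OF s]) (simp add: cb)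
  then have 1: "col_of \<beta> ?g 1 = k" by (simp add: extend_tab_new) (simp add: new_cell_def)
  have 2: "col_of \<beta> ?g (Suc j) = col_of \<alpha> \<tau> j" if j: "j \<in> {1..sum_list \<alpha>}" for j
  proof -
    have "j \<in> \<tau> ` cells \<alpha>" using srct_bij[OF assms(2)] j by (simp add: bij_betw_def)
    then obtain x where x: "x \<in> cells \<alpha>" "\<tau> x = j" by blast
    have "col_of \<beta> ?g (?g (old_cell k x)) = snd (old_cell k x)"
      by (rule col_of_eq[OF s]) (use x in \<open>simp add: cb\<close>)
    also have "?g (old_cell k x) = Suc j" using extend_tab_old[OF assms(1)] x by simp
    also have "snd (old_cell k x) = snd x" by (simp add: old_cell_def split: prod.split)
    also have "snd x = col_of \<alpha> \<tau> j" using col_of_eq[OF assms(2) x(1)] x(2) by simp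
    finally show ?thesis .
  qed
  have "[1..<Suc (Suc n)] = 1 # map Suc [1..<Suc n]" for n
    unfolding map_Suc_upt by (subst upt_conv_Cons) simp_all
  then show ?thesis
    using add_cell_Some_comp[OF assms(1)] 1 2 by (simp add: col_word_def del: upt_Suc)
qed

lemma srct_tab_of_word:
  "add_cells w [] = Some \<alpha> \<Longrightarrow> srct \<alpha> (tab_of_word w) \<and> col_word \<alpha> (tab_of_word w) = w"
proof (induction w arbitrary: \<alpha>)
  case Nil
  then show ?case by (auto simp: srct_def cells_def col_word_def bij_betw_def)
next
  case (Cons c w)
  then obtain \<gamma> where g: "add_cells w [] = Some \<gamma>" "add_cell c \<gamma> = Some \<alpha>"
    by (auto simp: bind_eq_Some_conv)
  have "is_comp \<gamma>" using add_cells_Some_comp[OF g(1)] by simp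
  then show ?case using Cons.IH[OF g(1)] g by (simp add: srct_extend_tab col_word_extend_tab)
qed

lemma srct_word:
  "srct \<alpha> \<tau> \<Longrightarrow> is_comp \<alpha> \<Longrightarrow> \<exists>w. add_cells w [] = Some \<alpha> \<and> \<tau> = tab_of_word w"
proof (induction "sum_list \<alpha>" arbitrary: \<alpha> \<tau>)
  case 0
  then have "\<alpha> = []" by (cases \<alpha>) auto
  then have "\<tau> = (\<lambda>_. 0)" using srct_outside[OF 0(2)] by (auto simp: cells_def)
  then show ?case using \<open>\<alpha> = []\<close> by (intro exI[of _ "[]"]) simp
next
  case (Suc n)
  then have "\<alpha> \<noteq> []" by auto
  then obtain k \<gamma> \<tau>' where g: "is_comp \<gamma>" "add_cell k \<gamma> = Some \<alpha>" "srct \<gamma> \<tau>'" "\<tau> = extend_tab k \<gamma> \<tau>'"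
    using srct_remove_first[OF Suc.prems] by metis
  then have "n = sum_list \<gamma>" using add_cell_Some_comp[OF g(2)] Suc.hyps by simp
  from Suc.hyps(1)[OF this g(3,1)] obtain w where "add_cells w [] = Some \<gamma>" "\<tau>' = tab_of_word w" by blast
  with g show ?case by (intro exI[of _ "k # w"]) simp
qed

text \<open>Words are indexed from 0 and entries from 1, so \<open>w ! (j - 1)\<close> is the column
  of the entry \<open>j\<close>.\<close>

definition word_descents :: "nat list \<Rightarrow> nat set" where
  "word_descents w = {j. 0 < j \<and> j < length w \<and> w ! (j - 1) \<le> w ! j}"

lemma descent_set_eq: "descent_set \<alpha> \<tau> = word_descents (col_word \<alpha> \<tau>)"
  by (auto simp: descent_set_def word_descents_def col_word_def nth_upt simp del: upt_Suc)

lemma dcoef_eq: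
  assumes "is_comp \<alpha>"
  shows "dcoef \<alpha> \<beta> =
    card {w. add_cells w [] = Some \<alpha> \<and> comp_of_set (sum_list \<alpha>) (word_descents w) = \<beta>}"
proof -
  have "bij_betw tab_of_word {w. add_cells w [] = Some \<alpha> \<and> comp_of_set (sum_list \<alpha>) (word_descents w) = \<beta>}
      {\<tau>. srct \<alpha> \<tau> \<and> descent_comp \<alpha> \<tau> = \<beta>}"
    unfolding bij_betw_def
  proof
    show "inj_on tab_of_word {w. add_cells w [] = Some \<alpha> \<and> comp_of_set (sum_list \<alpha>) (word_descents w) = \<beta>}"
      by (rule inj_on_inverseI[where g = "col_word \<alpha>"]) (simp add: srct_tab_of_word)
    show "tab_of_word ` {w. add_cells w [] = Some \<alpha> \<and> comp_of_set (sum_list \<alpha>) (word_descents w) = \<beta>} =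
      {\<tau>. srct \<alpha> \<tau> \<and> descent_comp \<alpha> \<tau> = \<beta>}"
      using srct_word[OF _ assms] srct_tab_of_word
      by (fastforce simp: descent_comp_def descent_set_eq)
  qed
  then show ?thesis unfolding dcoef_def by (simp add: bij_betw_same_card)
qed

subsection \<open>Descents of words and ribbons\<close>

definition strict_words :: "nat \<Rightarrow> nat \<Rightarrow> nat list set" where
  "strict_words N k = {w. length w = k \<and> sorted_wrt (>) w \<and> set w \<subseteq> {..<N}}"

lemma finite_strict_words: "finite (strict_words N k)"
  by (rule finite_subset[OF _ finite_lists_length_eq[of "{..<N}" k]]) (auto simp: strict_words_def)

lemma strict_words_Suc:
  "strict_words (Suc N) (Suc k) = strict_words N (Suc k) \<union> (#) N ` strict_words N k"
proof (intro set_eqI iffI)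
  fix w assume w: "w \<in> strict_words (Suc N) (Suc k)"
  then obtain c u where cu: "w = c # u" by (cases w) (auto simp: strict_words_def)
  show "w \<in> strict_words N (Suc k) \<union> (#) N ` strict_words N k"
  proof (cases "c = N")
    case True
    then show ?thesis using w cu by (auto simp: strict_words_def)
  next
    case False
    then have "c < N" using w cu by (simp add: strict_words_def)
    then show ?thesis using w cu by (force simp: strict_words_def)
  qed
qed (auto simp: strict_words_def less_Suc_eq)

lemma pull_add_cells_Cons: "pull (add_cells (c # w)) f = pull (add_cells w) (pull (add_cell c) f)"
  by (simp add: pull_pull fun_eq_iff) (simp add: pull_def)

lemma hstrip_eq: "hstrip N k f \<alpha> = (\<Sum>w\<in>strict_words N k. pull (add_cells w) f \<alpha>)"
proof (induction N k f \<alpha> rule: hstrip.induct)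
  case (1 N f \<alpha>)
  have "strict_words N 0 = {[]}" by (auto simp: strict_words_def)
  then show ?case by (simp add: pull_def)
next
  case (2 k f \<alpha>)
  have "strict_words 0 (Suc k) = {}" by (auto simp: strict_words_def)
  then show ?case by simp
next
  case (3 N k f \<alpha>)
  have "(\<Sum>w\<in>strict_words (Suc N) (Suc k). pull (add_cells w) f \<alpha>) =
      (\<Sum>w\<in>strict_words N (Suc k). pull (add_cells w) f \<alpha>) +
      (\<Sum>w\<in>(#) N ` strict_words N k. pull (add_cells w) f \<alpha>)"
    unfolding strict_words_Suc
    by (rule sum.union_disjoint) (auto simp: finite_strict_words, auto simp: strict_words_def)
  also have "(\<Sum>w\<in>(#) N ` strict_words N k. pull (add_cells w) f \<alpha>) =
      (\<Sum>w\<in>strict_words N k. pull (add_cells (N # w)) f \<alpha>)"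
    by (subst sum.reindex) (auto simp: inj_on_def)
  finally show ?case using 3 by (simp only: hstrip.simps pull_add_cells_Cons)
qed

text \<open>The first part is pulled back innermost and so acts last, like the first block of
  letters of a word.\<close>

fun hstrips :: "nat \<Rightarrow> nat list \<Rightarrow> (nat list \<Rightarrow> rat) \<Rightarrow> nat list \<Rightarrow> rat" where
  "hstrips N [] f = f"
| "hstrips N (a # as) f = hstrips N as (hstrip N a f)"

lemma psums_Nil [simp]: "psums [] = {0}"
  by (auto simp: psums_def)

lemma psums_Cons: "psums (a # as) = insert 0 ((+) a ` psums as)"
proof -
  have "psums (a # as) = (\<lambda>k. sum_list (take k (a # as))) ` {..Suc (length as)}"
    by (auto simp: psums_def)
  also have "\<dots> = insert 0 ((+) a ` (\<lambda>k. sum_list (take k as)) ` {..length as})"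
    by (simp add: atMost_Suc_eq_insert_0 image_image)
  also have "(\<lambda>k. sum_list (take k as)) ` {..length as} = psums as"
    by (auto simp: psums_def)
  finally show ?thesis .
qed

lemma zero_in_psums [simp]: "0 \<in> psums a" by (cases a) (auto simp: psums_Cons)

lemma sum_in_psums: "sum_list a \<in> psums a" by (induction a) (auto simp: psums_Cons)

lemma finite_psums [simp]: "finite (psums a)" by (induction a) (auto simp: psums_Cons)

lemma psums_le: "x \<in> psums a \<Longrightarrow> x \<le> sum_list a"
  by (induction a arbitrary: x) (auto simp: psums_Cons)

text \<open>Words cut into strictly decreasing blocks of lengths \<open>a\<close>. Phrasing this
  through descents links products of strips directly to tableaux with restricted descent
  set.\<close>

definition block_words :: "nat \<Rightarrow> nat list \<Rightarrow> nat list set" where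
  "block_words N a = {w. length w = sum_list a \<and> set w \<subseteq> {..<N} \<and> word_descents w \<subseteq> psums a}"

lemma finite_block_words: "finite (block_words N a)"
  by (rule finite_subset[OF _ finite_lists_length_eq[of "{..<N}" "sum_list a"]]) (auto simp: block_words_def)

lemma word_descents_Suc: "Suc i \<in> word_descents w \<longleftrightarrow> Suc i < length w \<and> w ! i \<le> w ! Suc i"
  by (simp add: word_descents_def)

lemma zero_notin_word_descents [simp]: "0 \<notin> word_descents w"
  by (simp add: word_descents_def)

lemma word_descents_empty_iff: "word_descents w = {} \<longleftrightarrow> sorted_wrt (>) w"
proof -
  have "word_descents w = {} \<longleftrightarrow> (\<forall>i. Suc i \<notin> word_descents w)"
    by (metis all_not_in_conv not0_implies_Suc zero_notin_word_descents)
  also have "\<dots> \<longleftrightarrow> sorted_wrt (>) w"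
    by (subst sorted_wrt_iff_nth_Suc_transp) (auto simp: word_descents_Suc transp_def not_le)
  finally show ?thesis .
qed

lemma word_descents_append:
  assumes "v \<noteq> []" "u \<noteq> []"
  shows "word_descents (u @ v) =
    word_descents u \<union> (if last u \<le> hd v then {length u} else {}) \<union> (+) (length u) ` word_descents v"
proof -
  have "j \<in> word_descents (u @ v) \<longleftrightarrow> j \<in> word_descents u \<or> (j = length u \<and> last u \<le> hd v) \<or>
      (length u < j \<and> j - length u \<in> word_descents v)" for j
    using assms
    by (cases j "length u" rule: linorder_cases)
       (auto simp: word_descents_def nth_append last_conv_nth hd_conv_nth Suc_diff_Suc)
  moreover have "(length u < j \<and> j - length u \<in> word_descents v) \<longleftrightarrow> j \<in> (+) (length u) ` word_descents v" for j
    by (auto simp: image_iff intro!: bexI[of _ "j - length u"] gr0I)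
  ultimately show ?thesis by auto
qed

text \<open>The element 0 of \<open>P\<close> permits a descent at the junction, so only the
  interiors of \<open>u\<close> and \<open>v\<close> are constrained. The inserted 0 is never a
  descent.\<close>

lemma word_descents_append_subset_iff:
  assumes "0 \<in> P"
  shows "word_descents (u @ v) \<subseteq> insert 0 ((+) (length u) ` P) \<longleftrightarrow>
    sorted_wrt (>) u \<and> word_descents v \<subseteq> P"
proof (cases "u = [] \<or> v = []")
  case True
  have less: "j < length w" if "j \<in> word_descents w" for j w using that by (simp add: word_descents_def)
  have "word_descents u \<subseteq> insert 0 ((+) (length u) ` P) \<longleftrightarrow> word_descents u = {}"
    using less by fastforce
  then show ?thesis using True assms
    by (auto simp: word_descents_empty_iff) (auto simp: word_descents_def)
next
  case False
  have less: "j < length w \<and> 0 < j" if "j \<in> word_descents w" for j w using that by (simp add: word_descents_def)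
  have u: "word_descents u \<subseteq> insert 0 ((+) (length u) ` P) \<longleftrightarrow> word_descents u = {}"
    using less by fastforce
  have v: "(+) (length u) ` word_descents v \<subseteq> insert 0 ((+) (length u) ` P) \<longleftrightarrow> word_descents v \<subseteq> P"
    using False by auto
  show ?thesis using False assms u v
    by (simp add: word_descents_append word_descents_empty_iff)
qed

lemma block_words_Cons:
  "block_words N (k # a) = (\<lambda>(u, v). u @ v) ` (strict_words N k \<times> block_words N a)"
proof (intro set_eqI iffI)
  fix w assume w: "w \<in> block_words N (k # a)"
  define u v where "u = take k w" and "v = drop k w"
  have "length u = k" "length v = sum_list a" "w = u @ v"
    using w by (auto simp: block_words_def u_def v_def)
  then show "w \<in> (\<lambda>(u, v). u @ v) ` (strict_words N k \<times> block_words N a)"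
    using w word_descents_append_subset_iff[of "psums a" u v]
    by (auto simp: block_words_def strict_words_def psums_Cons intro!: image_eqI[of _ _ "(u, v)"])
next
  fix w assume "w \<in> (\<lambda>(u, v). u @ v) ` (strict_words N k \<times> block_words N a)"
  then obtain u v where "w = u @ v" "u \<in> strict_words N k" "v \<in> block_words N a" by auto
  then show "w \<in> block_words N (k # a)"
    using word_descents_append_subset_iff[of "psums a" u v]
    by (auto simp: block_words_def strict_words_def psums_Cons)
qed

lemma hstrips_eq: "hstrips N a f \<alpha> = (\<Sum>w\<in>block_words N a. pull (add_cells w) f \<alpha>)"
proof (induction a arbitrary: f)
  case Nil
  have "block_words N [] = {[]}" by (auto simp: block_words_def word_descents_def)
  then show ?case by (simp add: pull_def)
next
  case (Cons k a)
  have "hstrips N (k # a) f \<alpha> = (\<Sum>v\<in>block_words N a. \<Sum>u\<in>strict_words N k. pull (add_cells (u @ v)) f \<alpha>)"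
    using Cons by (simp add: hstrip_eq[abs_def] pull_sum pull_pull add_cells_append[abs_def])
  also have "\<dots> = (\<Sum>(u, v)\<in>strict_words N k \<times> block_words N a. pull (add_cells (u @ v)) f \<alpha>)"
    by (subst sum.swap) (simp add: sum.cartesian_product)
  also have "\<dots> = (\<Sum>w\<in>block_words N (k # a). pull (add_cells w) f \<alpha>)"
    unfolding block_words_Cons
    by (subst sum.reindex) (auto simp: inj_on_def strict_words_def intro!: sum.cong)
  finally show ?case .
qed

section \<open>Compositions as sets of partial sums\<close>

lemma finite_comps: "finite (comps n)"
proof (rule finite_subset[OF _ finite_lists_length_le[of "{..n}" n]])
  have "length \<alpha> \<le> sum_list \<alpha>" if "is_comp \<alpha>" for \<alpha> using that by (induction \<alpha>) auto
  then show "comps n \<subseteq> {xs. set xs \<subseteq> {..n} \<and> length xs \<le> n}"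
    by (auto simp: comps_def intro: member_le_sum_list)
qed simp

lemma psums_eq_zero: "is_comp b \<Longrightarrow> psums b = {0} \<Longrightarrow> b = []"
  using sum_in_psums[of b] by (cases b) auto

text \<open>The first part is the least nonzero partial sum; removing it and shifting gives the
  partial sums of the rest.\<close>

lemma psums_inj: "is_comp a \<Longrightarrow> is_comp b \<Longrightarrow> psums a = psums b \<Longrightarrow> a = b"
proof (induction a arbitrary: b)
  case Nil
  then show ?case using psums_eq_zero[of b] by simp
next
  case (Cons x a)
  have "b \<noteq> []"
    using psums_eq_zero[of "x # a"] Cons.prems by auto
  then obtain y b' where b: "b = y # b'" by (cases b) auto
  have pos: "0 < x" "0 < y" using Cons.prems b by auto
  have *: "psums (x # a) - {0} = (+) x ` psums a" if "0 < x" for x and a using that by (auto simp: psums_Cons)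
  have mn: "Min ((+) x ` psums a) = x" for x and a by (rule Min_eqI) (auto intro!: image_eqI[of _ _ 0])
  have e: "(+) x ` psums a = (+) y ` psums b'" using Cons.prems(3) *[OF pos(1), of a] *[OF pos(2), of b'] b by metis
  then have "x = y" using mn by metis
  then have "psums a = psums b'" using e by (simp add: inj_image_eq_iff)
  then show ?case using Cons b \<open>x = y\<close> by auto
qed

lemma psums_surj:
  "B \<subseteq> {0..n} \<Longrightarrow> 0 \<in> B \<Longrightarrow> n \<in> B \<Longrightarrow> \<exists>a\<in>comps n. psums a = B"
proof (induction n arbitrary: B rule: less_induct)
  case (less n)
  show ?case
  proof (cases "n = 0")
    case True
    then have "psums [] = B" using less.prems by auto
    then show ?thesis using True by (intro bexI[of _ "[]"]) (auto simp: comps_def)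
  next
    case False
    have fin: "finite (B - {0})" using less.prems(1) finite_subset by blast
    define m where "m = Min (B - {0})"
    have m: "m \<in> B - {0}" unfolding m_def using fin False less.prems by (intro Min_in) auto
    have ml: "m \<le> x" if "x \<in> B" "x \<noteq> 0" for x unfolding m_def using fin that by (intro Min_le) auto
    define B' where "B' = (\<lambda>x. x - m) ` (B - {0})"
    have mn: "m \<le> n" "0 < m" using m less.prems(1) by auto
    have "\<exists>a\<in>comps (n - m). psums a = B'"
    proof (rule less.IH)
      show "n - m < n" using mn by simp
      show "B' \<subseteq> {0..n - m}" using less.prems(1) by (auto simp: B'_def)
      show "0 \<in> B'" using m by (auto simp: B'_def intro!: image_eqI[of _ _ m])
      show "n - m \<in> B'" using less.prems(3) False by (auto simp: B'_def)
    qed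
    then obtain a where a: "a \<in> comps (n - m)" "psums a = B'" by blast
    have "(+) m ` B' = (\<lambda>x. x) ` (B - {0})"
      unfolding B'_def image_image using ml by (intro image_cong) auto
    then have "psums (m # a) = B" using less.prems(2) by (auto simp: psums_Cons a(2))
    moreover have "m # a \<in> comps n" using a(1) mn by (auto simp: comps_def)
    ultimately show ?thesis by blast
  qed
qed

lemma card_psums: "is_comp a \<Longrightarrow> card (psums a) = Suc (length a)"
proof (induction a)
  case (Cons x a)
  then have "0 \<notin> (+) x ` psums a" by auto
  then show ?case using Cons by (simp add: psums_Cons card_image)
qed simp

lemma comp_of_set_eq_iff:
  assumes "D \<subseteq> {1..<m}"
  shows "comp_of_set m D = \<beta> \<longleftrightarrow> \<beta> \<in> comps m \<and> psums \<beta> = D \<union> {0, m}"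
proof -
  obtain a where a: "a \<in> comps m" "psums a = D \<union> {0, m}"
    using psums_surj[of "D \<union> {0, m}" m] assms by force
  have "comp_of_set m D = a" unfolding comp_of_set_def
    using a by (intro the_equality) (auto simp: comps_def intro: psums_inj)
  then show ?thesis using a by (auto simp: comps_def intro: psums_inj)
qed

text \<open>Expansion of the product of the factors -1 + 1 over \<open>X\<close>.\<close>

lemma sum_Pow_alternating:
  "finite X \<Longrightarrow> (\<Sum>C\<in>Pow X. (- 1) ^ card C) = (if X = {} then 1 else 0 :: rat)"
  using prod_add[of X "\<lambda>_. - 1 :: rat" "\<lambda>_. 1"] by (simp add: card_gt_0_iff power_0_left)

text \<open>Moebius inversion: the coefficient of \<open>h_v\<close> is an alternating sum over all
  sets between \<open>psums v\<close> and \<open>psums a\<close>, an interval of a Boolean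
  lattice.\<close>

lemma sum_ribbon:
  assumes "a \<in> comps n" "v \<in> comps n"
  shows "(\<Sum>\<beta> | \<beta> \<in> comps n \<and> psums \<beta> \<subseteq> psums a. ribbon \<beta> v) = (if v = a then 1 else 0)"
proof -
  have *: "ribbon \<beta> v = (if psums v \<subseteq> psums \<beta> then (- 1) ^ card (psums \<beta> - psums v) else 0)"
    if "\<beta> \<in> comps n" for \<beta>
    using that assms card_psums[of \<beta>] card_psums[of v]
    by (auto simp: ribbon_def coarsens_def comps_def card_Diff_subset)
  let ?I = "{\<beta> \<in> comps n. psums v \<subseteq> psums \<beta> \<and> psums \<beta> \<subseteq> psums a}"
  have "(\<Sum>\<beta> | \<beta> \<in> comps n \<and> psums \<beta> \<subseteq> psums a. ribbon \<beta> v) =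
      (\<Sum>\<beta>\<in>?I. (- 1) ^ card (psums \<beta> - psums v))"
    by (rule sum.mono_neutral_cong_right) (auto simp: finite_comps *)
  also have "\<dots> = (if v = a then 1 else 0)"
  proof (cases "psums v \<subseteq> psums a")
    case False
    then have "?I = {}" "v \<noteq> a" by auto
    then show ?thesis by (simp only: sum.empty if_False)
  next
    case True
    have "bij_betw (\<lambda>\<beta>. psums \<beta> - psums v) ?I (Pow (psums a - psums v))"
      unfolding bij_betw_def
    proof
      show "inj_on (\<lambda>\<beta>. psums \<beta> - psums v) ?I"
      proof (rule inj_onI)
        fix x y assume "x \<in> ?I" "y \<in> ?I" "psums x - psums v = psums y - psums v"
        then show "x = y" by (intro psums_inj) (auto simp: comps_def)
      qed
      show "(\<lambda>\<beta>. psums \<beta> - psums v) ` ?I = Pow (psums a - psums v)"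
      proof (intro equalityI subsetI)
        fix C assume C: "C \<in> Pow (psums a - psums v)"
        have "C \<union> psums v \<subseteq> {0..n}" using C True psums_le[of _ a] assms by (fastforce simp: comps_def)
        moreover have "n \<in> C \<union> psums v" using sum_in_psums[of v] assms by (simp add: comps_def)
        ultimately obtain b where "b \<in> comps n" "psums b = C \<union> psums v"
          using psums_surj[of "C \<union> psums v" n] by auto
        then show "C \<in> (\<lambda>\<beta>. psums \<beta> - psums v) ` ?I"
          using C True by (intro image_eqI[of _ _ b]) auto
      qed auto
    qed
    then have "(\<Sum>\<beta>\<in>?I. (- 1) ^ card (psums \<beta> - psums v)) = (\<Sum>C\<in>Pow (psums a - psums v). (- 1) ^ card C :: rat)"
      by (rule sum.reindex_bij_betw)
    also have "\<dots> = (if v = a then 1 else 0)"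
      using True assms psums_inj[of v a] by (auto simp: sum_Pow_alternating comps_def)
    finally show ?thesis .
  qed
  finally show ?thesis .
qed

subsection \<open>Triangularity\<close>

text \<open>Shows that a column bound of at least the size loses no tableau.\<close>

lemma add_cells_letters: "add_cells w [] = Some \<gamma> \<Longrightarrow> set w \<subseteq> {..<length w}"
proof (induction w arbitrary: \<gamma>)
  case (Cons c w)
  then obtain \<beta> where b: "add_cells w [] = Some \<beta>" "add_cell c \<beta> = Some \<gamma>"
    by (auto simp: bind_eq_Some_conv)
  have "c = 0 \<or> c \<in> set \<beta>"
    using b(2) by (auto simp: add_cell_def split: if_splits) (metis inc_first_None option.distinct(1))
  moreover have "sum_list \<beta> = length w" using add_cells_Some_comp[OF b(1)] by simp
  ultimately have "c \<le> length w" using member_le_sum_list[of c \<beta>] by auto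
  then show ?case using Cons.IH[OF b(1)] by auto
qed simp

lemma add_cells_in_comps: "add_cells w [] = Some \<gamma> \<Longrightarrow> \<gamma> \<in> comps (length w)"
  using add_cells_Some_comp[of w "[]" \<gamma>] by (simp add: comps_def)

text \<open>Analogue of the Kostka numbers: the coefficient of s_\<gamma> in
  \<open>h_a\<close>.\<close>

definition kostka :: "nat list \<Rightarrow> nat list \<Rightarrow> nat" where
  "kostka \<gamma> a = card {w. add_cells w [] = Some \<gamma> \<and> word_descents w \<subseteq> psums a}"

lemma finite_words: "finite {w. add_cells w [] = Some \<gamma> \<and> P w}"
proof (rule finite_subset)
  show "{w. add_cells w [] = Some \<gamma> \<and> P w} \<subseteq> {w. set w \<subseteq> {..<sum_list \<gamma>} \<and> length w = sum_list \<gamma>}"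
    using add_cells_letters add_cells_Some_comp by fastforce
qed (simp add: finite_lists_length_eq)

lemma word_descents_bounds: "word_descents w \<subseteq> {1..<length w}"
  by (auto simp: word_descents_def)

lemma dcoef_psums:
  assumes "\<gamma> \<in> comps n" "\<beta> \<in> comps n"
  shows "dcoef \<gamma> \<beta> = card {w. add_cells w [] = Some \<gamma> \<and> psums \<beta> = word_descents w \<union> {0, n}}"
proof -
  have "comp_of_set n (word_descents w) = \<beta> \<longleftrightarrow> psums \<beta> = word_descents w \<union> {0, n}"
    if "add_cells w [] = Some \<gamma>" for w
  proof -
    have "length w = n" using add_cells_Some_comp[OF that] assms(1) by (simp add: comps_def)
    then show ?thesis using comp_of_set_eq_iff[of "word_descents w" n \<beta>] word_descents_bounds[of w] assms(2) by simp
  qed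
  then show ?thesis using assms dcoef_eq[of \<gamma> \<beta>] by (simp add: comps_def cong: conj_cong)
qed

lemma sum_dcoef_eq_kostka:
  assumes "\<gamma> \<in> comps n" "a \<in> comps n"
  shows "(\<Sum>\<beta> | \<beta> \<in> comps n \<and> psums \<beta> \<subseteq> psums a. dcoef \<gamma> \<beta>) = kostka \<gamma> a"
proof -
  let ?I = "{\<beta>. \<beta> \<in> comps n \<and> psums \<beta> \<subseteq> psums a}"
  let ?W = "\<lambda>\<beta>. {w. add_cells w [] = Some \<gamma> \<and> psums \<beta> = word_descents w \<union> {0, n}}"
  have "(\<Sum>\<beta>\<in>?I. dcoef \<gamma> \<beta>) = (\<Sum>\<beta>\<in>?I. card (?W \<beta>))"
    using assms by (intro sum.cong) (auto simp: dcoef_psums)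
  also have "\<dots> = card (\<Union>\<beta>\<in>?I. ?W \<beta>)"
  proof (rule card_UN_disjoint[symmetric])
    show "finite ?I" by (simp add: finite_comps)
    show "\<forall>i\<in>?I. finite (?W i)" by (simp add: finite_words)
    show "\<forall>i\<in>?I. \<forall>j\<in>?I. i \<noteq> j \<longrightarrow> ?W i \<inter> ?W j = {}"
    proof (intro ballI impI equals0I)
      fix i j w assume "i \<in> ?I" "j \<in> ?I" "i \<noteq> j" "w \<in> ?W i \<inter> ?W j"
      then show False using psums_inj[of i j] by (auto simp: comps_def)
    qed
  qed
  also have "(\<Union>\<beta>\<in>?I. ?W \<beta>) = {w. add_cells w [] = Some \<gamma> \<and> word_descents w \<subseteq> psums a}"
  proof (intro equalityI subsetI)
    fix w assume "w \<in> {w. add_cells w [] = Some \<gamma> \<and> word_descents w \<subseteq> psums a}"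
    then have w: "add_cells w [] = Some \<gamma>" "word_descents w \<subseteq> psums a" by auto
    have "length w = n" using add_cells_Some_comp[OF w(1)] assms(1) by (simp add: comps_def)
    then have "word_descents w \<union> {0, n} \<subseteq> {0..n}" using word_descents_bounds[of w] by auto
    then obtain \<beta> where "\<beta> \<in> comps n" "psums \<beta> = word_descents w \<union> {0, n}"
      using psums_surj[of "word_descents w \<union> {0, n}" n] by auto
    moreover have "n \<in> psums a" using sum_in_psums[of a] assms(2) by (simp add: comps_def)
    ultimately show "w \<in> (\<Union>\<beta>\<in>?I. ?W \<beta>)" using w by (intro UN_I[of \<beta>]) auto
  qed auto
  finally show ?thesis by (simp add: kostka_def)
qed

text \<open>Sorts the block words by the shape they build; words that build nothing contribute 0.
  The result no longer depends on \<open>N\<close>.\<close>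

lemma hstrips_kostka:
  assumes "sum_list a = n" "n \<le> N"
  shows "hstrips N a f [] = (\<Sum>\<gamma>\<in>comps n. of_nat (kostka \<gamma> a) * f \<gamma>)"
proof -
  have "pull (add_cells w) f [] = (\<Sum>\<gamma>\<in>comps n. if add_cells w [] = Some \<gamma> then f \<gamma> else 0)"
    if "w \<in> block_words N a" for w
  proof (cases "add_cells w []")
    case None
    then show ?thesis by (simp add: pull_def)
  next
    case (Some \<delta>)
    then have "\<delta> \<in> comps n" using add_cells_in_comps[OF Some] that assms by (simp add: block_words_def)
    then show ?thesis using Some by (simp add: pull_def finite_comps)
  qed
  then have "hstrips N a f [] =
      (\<Sum>\<gamma>\<in>comps n. \<Sum>w\<in>block_words N a. if add_cells w [] = Some \<gamma> then f \<gamma> else 0)"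
    unfolding hstrips_eq by (subst sum.swap) simp
  also have "\<dots> = (\<Sum>\<gamma>\<in>comps n. of_nat (kostka \<gamma> a) * f \<gamma>)"
  proof (rule sum.cong[OF refl])
    fix \<gamma> assume g: "\<gamma> \<in> comps n"
    have "{w \<in> block_words N a. add_cells w [] = Some \<gamma>} =
        {w. add_cells w [] = Some \<gamma> \<and> word_descents w \<subseteq> psums a}"
      using add_cells_Some_comp[of _ "[]" \<gamma>] add_cells_letters[of _ \<gamma>] g assms
      by (fastforce simp: block_words_def comps_def)
    then have "(\<Sum>w\<in>block_words N a. if add_cells w [] = Some \<gamma> then f \<gamma> else 0) =
        (\<Sum>w | add_cells w [] = Some \<gamma> \<and> word_descents w \<subseteq> psums a. f \<gamma>)"
      by (subst sum.inter_filter[symmetric]) (simp_all add: finite_block_words)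
    then show "(\<Sum>w\<in>block_words N a. if add_cells w [] = Some \<gamma> then f \<gamma> else 0) = of_nat (kostka \<gamma> a) * f \<gamma>"
      by (simp add: kostka_def)
  qed
  finally show ?thesis .
qed

lemma sum_dcoef:
  assumes "a \<in> comps n" "n \<le> N"
  shows "(\<Sum>\<beta> | \<beta> \<in> comps n \<and> psums \<beta> \<subseteq> psums a. \<Sum>\<gamma>\<in>comps n. of_nat (dcoef \<gamma> \<beta>) * f \<gamma>) = hstrips N a f []"
proof -
  have "(\<Sum>\<beta> | \<beta> \<in> comps n \<and> psums \<beta> \<subseteq> psums a. \<Sum>\<gamma>\<in>comps n. of_nat (dcoef \<gamma> \<beta>) * f \<gamma>) =
      (\<Sum>\<gamma>\<in>comps n. of_nat (\<Sum>\<beta> | \<beta> \<in> comps n \<and> psums \<beta> \<subseteq> psums a. dcoef \<gamma> \<beta>) * f \<gamma>)"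
    by (subst sum.swap) (simp add: sum_distrib_right)
  also have "\<dots> = (\<Sum>\<gamma>\<in>comps n. of_nat (kostka \<gamma> a) * f \<gamma>)"
    using assms(1) by (intro sum.cong) (simp_all only: sum_dcoef_eq_kostka)
  also have "\<dots> = hstrips N a f []"
    using assms hstrips_kostka[of a n N f] by (simp add: comps_def)
  finally show ?thesis .
qed

text \<open>The sum of the column indices of all cells, hence the letter sum of every word that
  builds \<open>\<alpha>\<close> from the empty composition.\<close>

definition col_sum :: "nat list \<Rightarrow> nat" where
  "col_sum \<alpha> = (\<Sum>k\<leftarrow>\<alpha>. \<Sum>{..<k})"

lemma add_cell_col_sum: "add_cell k \<alpha> = Some \<beta> \<Longrightarrow> col_sum \<beta> = col_sum \<alpha> + k"
proof -
  have "inc_first k \<alpha> = Some \<beta> \<Longrightarrow> col_sum \<beta> = col_sum \<alpha> + k"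
    by (induction \<alpha> arbitrary: \<beta>) (auto simp: col_sum_def split: if_splits)
  then show "add_cell k \<alpha> = Some \<beta> \<Longrightarrow> col_sum \<beta> = col_sum \<alpha> + k"
    by (auto simp: add_cell_def col_sum_def split: if_splits)
qed

lemma add_cells_col_sum: "add_cells w \<alpha> = Some \<beta> \<Longrightarrow> col_sum \<beta> = col_sum \<alpha> + sum_list w"
  by (induction w arbitrary: \<beta>) (auto simp: bind_eq_Some_conv dest!: add_cell_col_sum)

lemma strict_word_sum:
  "sorted_wrt (>) u \<Longrightarrow> u = rev [0..<length u] \<or> \<Sum>{..<length u} < sum_list (u :: nat list)"
proof (induction u)
  case (Cons c u)
  \<comment> \<open>The letters after \<open>c\<close> are distinct and smaller than
    \<open>c\<close>, so \<open>c\<close> is at least their number.\<close>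
  have "card (set u) \<le> card {..<c}" using Cons.prems by (intro card_mono) auto
  moreover have "sorted_wrt (>) v \<Longrightarrow> distinct v" for v :: "nat list" by (induction v) auto
  with Cons.prems have "distinct u" by simp
  ultimately have "length u \<le> c" by (simp add: distinct_card)
  moreover have "\<Sum>{..<length u} = sum_list u" if "u = rev [0..<length u]"
    by (subst (2) that) (simp add: interv_sum_list_conv_sum_set_nat atLeast0LessThan)
  ultimately show ?case using Cons by (cases "c = length u") force+
qed simp

text \<open>Builds the rows from the last to the first, each from left to right. Among the block
  words of \<open>a\<close> it is the only one with least letter sum.\<close>

definition canonical_word :: "nat list \<Rightarrow> nat list" where
  "canonical_word a = concat (map (\<lambda>k. rev [0..<k]) a)"

lemma block_word_sum:
  "length w = sum_list a \<Longrightarrow> word_descents w \<subseteq> psums a \<Longrightarrow>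
    w = canonical_word a \<or> col_sum a < sum_list w"
proof (induction a arbitrary: w)
  case Nil
  then show ?case by (simp add: canonical_word_def)
next
  case (Cons k a)
  define u v where "u = take k w" and "v = drop k w"
  have w: "w = u @ v" "length u = k" "length v = sum_list a"
    using Cons.prems by (auto simp: u_def v_def)
  have "sorted_wrt (>) u \<and> word_descents v \<subseteq> psums a"
    using Cons.prems(2) word_descents_append_subset_iff[of "psums a" u v] w by (simp add: psums_Cons)
  then have 1: "u = rev [0..<k] \<or> \<Sum>{..<k} < sum_list u" and 2: "v = canonical_word a \<or> col_sum a < sum_list v"
    using strict_word_sum[of u] Cons.IH[of v] w by auto
  have 3: "sum_list u = \<Sum>{..<k}" if "u = rev [0..<k]"
    unfolding that by (simp add: interv_sum_list_conv_sum_set_nat atLeast0LessThan)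
  have "sum_list (canonical_word a) = col_sum a"
    by (induction a) (simp_all add: canonical_word_def col_sum_def interv_sum_list_conv_sum_set_nat atLeast0LessThan)
  then have 4: "sum_list v = col_sum a" if "v = canonical_word a" using that by simp
  have 5: "w = canonical_word (k # a)" if "u = rev [0..<k]" "v = canonical_word a"
    using that w(1) by (simp add: canonical_word_def)
  have "col_sum (k # a) = \<Sum>{..<k} + col_sum a" "sum_list w = sum_list u + sum_list v"
    using w(1) by (simp_all add: col_sum_def)
  then show ?case using 1 2 3 4 5 by linarith
qed

lemma add_cells_block: "0 < k \<Longrightarrow> add_cells (rev [0..<k]) \<alpha> = Some (k # \<alpha>)"
proof (induction k)
  case (Suc k)
  then show ?case by (cases k) (auto simp: add_cell_def)
qed simp

lemma add_cells_canonical: "is_comp a \<Longrightarrow> add_cells (canonical_word a) [] = Some a"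
  by (induction a) (auto simp: canonical_word_def add_cells_append add_cells_block)

lemma length_canonical [simp]: "length (canonical_word a) = sum_list a"
  by (induction a) (auto simp: canonical_word_def)

lemma descents_canonical:
  "is_comp a \<Longrightarrow> psums a = word_descents (canonical_word a) \<union> {0, sum_list a}"
proof (induction a)
  case Nil
  then show ?case by (simp add: canonical_word_def word_descents_def)
next
  case (Cons k a)
  have c: "canonical_word (k # a) = rev [0..<k] @ canonical_word a" by (simp add: canonical_word_def)
  have s: "word_descents (rev [0..<k]) = {}"
    by (simp add: word_descents_empty_iff sorted_wrt_rev)
  show ?case
  proof (cases "a = []")
    case True
    then show ?thesis using s c by (auto simp: psums_Cons canonical_word_def)
  next
    case False
    then have "0 < sum_list a" using Cons.prems by (cases a) auto
    then have "0 < length (canonical_word a)" by simp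
    then have "canonical_word a \<noteq> []" by (rule length_greater_0_conv[THEN iffD1])
    then have "word_descents (canonical_word (k # a)) = {k} \<union> (+) k ` word_descents (canonical_word a)"
      using Cons.prems s unfolding c by (subst word_descents_append) (auto simp: last_rev)
    then show ?thesis using Cons by (auto simp: psums_Cons)
  qed
qed

text \<open>The letter sum depends only on the shape built, and a block word of \<open>a\<close>
  other than the canonical one exceeds the minimum \<open>col_sum a\<close>.\<close>

lemma word_triangular:
  assumes "add_cells w [] = Some \<gamma>" "is_comp a" "sum_list \<gamma> = sum_list a" "word_descents w \<subseteq> psums a"
  shows "\<gamma> = a \<and> w = canonical_word a \<or> col_sum a < col_sum \<gamma>"
proof -
  have "col_sum \<gamma> = sum_list w" using add_cells_col_sum[OF assms(1)] by (simp add: col_sum_def)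
  moreover have "length w = sum_list a" using add_cells_Some_comp[OF assms(1)] assms(3) by simp
  ultimately show ?thesis using block_word_sum[of w a] add_cells_canonical[OF assms(2)] assms by auto
qed

section \<open>Unitriangular linear systems\<close>

text \<open>A height replaces a linear order: entries between distinct indices of equal height
  vanish.\<close>

definition unitriangular :: "'a set \<Rightarrow> ('a \<Rightarrow> nat) \<Rightarrow> ('a \<Rightarrow> 'a \<Rightarrow> nat) \<Rightarrow> bool" where
  "unitriangular I h M \<longleftrightarrow> (\<forall>a\<in>I. M a a = 1) \<and> (\<forall>a\<in>I. \<forall>b\<in>I. M b a \<noteq> 0 \<longrightarrow> b = a \<or> h a < h b)"

lemma unitriangular_kostka: "unitriangular (comps n) col_sum kostka"
  unfolding unitriangular_def
proof (intro conjI ballI impI)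
  fix a assume a: "a \<in> comps n"
  have "{w. add_cells w [] = Some a \<and> word_descents w \<subseteq> psums a} = {canonical_word a}"
    using a word_triangular[of _ a a] add_cells_canonical[of a] descents_canonical[of a] by (auto simp: comps_def)
  then show "kostka a a = 1" by (simp add: kostka_def)
next
  fix a b assume "a \<in> comps n" "b \<in> comps n" "kostka b a \<noteq> 0"
  then have "{w. add_cells w [] = Some b \<and> word_descents w \<subseteq> psums a} \<noteq> {}"
    unfolding kostka_def by (intro notI) simp
  then obtain w where "add_cells w [] = Some b" "word_descents w \<subseteq> psums a" by blast
  with \<open>a \<in> comps n\<close> \<open>b \<in> comps n\<close> show "b = a \<or> col_sum a < col_sum b"
    using word_triangular[of w b a] by (auto simp: comps_def)
qed

lemma unitriangular_dcoef: "unitriangular (comps n) col_sum dcoef"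
  unfolding unitriangular_def
proof (intro conjI ballI impI)
  fix a assume a: "a \<in> comps n"
  have "{w. add_cells w [] = Some a \<and> psums a = word_descents w \<union> {0, n}} = {canonical_word a}"
    using a word_triangular[of _ a a] add_cells_canonical[of a] descents_canonical[of a] by (auto simp: comps_def)
  then show "dcoef a a = 1" using dcoef_psums[OF a a] by simp
next
  fix a b assume ab: "a \<in> comps n" "b \<in> comps n" "dcoef b a \<noteq> 0"
  have "{w. add_cells w [] = Some b \<and> psums a = word_descents w \<union> {0, n}} \<noteq> {}"
    using ab(3) unfolding dcoef_psums[OF ab(2,1)] by (rule contrapos_nn) (simp only: card.empty)
  then obtain w where "add_cells w [] = Some b" "psums a = word_descents w \<union> {0, n}" by blast
  with ab(1,2) show "b = a \<or> col_sum a < col_sum b"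
    using word_triangular[of w b a] by (auto simp: comps_def)
qed

text \<open>Peel off an index \<open>p\<close> of largest height. No other index occurs in its
  equation, so \<open>x p\<close> is read off and substituted into the remaining ones. Solvability
  and uniqueness come from the same induction.\<close>

lemma unitriangular_solve:
  assumes "finite I" "unitriangular I h M"
  shows "\<exists>x :: 'a \<Rightarrow> rat. \<forall>a\<in>I. (\<Sum>b\<in>I. of_nat (M b a) * x b) = y a"
    and "(\<And>a. a \<in> I \<Longrightarrow> (\<Sum>b\<in>I. of_nat (M b a) * (x b :: rat)) = 0) \<Longrightarrow> a \<in> I \<Longrightarrow> x a = 0"
proof -
  have "unitriangular I h M \<longrightarrow> (\<forall>y. \<exists>x :: 'a \<Rightarrow> rat. \<forall>a\<in>I. (\<Sum>b\<in>I. of_nat (M b a) * x b) = y a) \<and>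
     (\<forall>x :: 'a \<Rightarrow> rat. (\<forall>a\<in>I. (\<Sum>b\<in>I. of_nat (M b a) * x b) = 0) \<longrightarrow> (\<forall>a\<in>I. x a = 0))"
    using assms(1)
  proof (induction I rule: finite_ranking_induct[where f = h])
    case (insert p I)
    show ?case
    proof
      assume ut: "unitriangular (insert p I) h M"
      show "(\<forall>y. \<exists>x :: 'a \<Rightarrow> rat. \<forall>a\<in>insert p I. (\<Sum>b\<in>insert p I. of_nat (M b a) * x b) = y a) \<and>
        (\<forall>x :: 'a \<Rightarrow> rat. (\<forall>a\<in>insert p I. (\<Sum>b\<in>insert p I. of_nat (M b a) * x b) = 0) \<longrightarrow> (\<forall>a\<in>insert p I. x a = 0))"
      proof (cases "p \<in> I")
        case True
        then show ?thesis using insert.IH ut by (simp add: insert_absorb)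
      next
        case False
        have ut': "unitriangular I h M" using ut by (auto simp: unitriangular_def)
        have IH1: "\<exists>x :: 'a \<Rightarrow> rat. \<forall>a\<in>I. (\<Sum>b\<in>I. of_nat (M b a) * x b) = y a" for y
          using insert.IH ut' by blast
        have IH2: "\<forall>a\<in>I. x a = 0" if "\<forall>a\<in>I. (\<Sum>b\<in>I. of_nat (M b a) * x b) = 0" for x :: "'a \<Rightarrow> rat"
          using insert.IH ut' that by blast
        have M0: "M b p = 0" if "b \<in> I" for b
          using ut insert.hyps(2)[OF that] that False unfolding unitriangular_def by fastforce
        have M1: "M p p = 1" using ut by (simp add: unitriangular_def)
        have eq: "(\<Sum>b\<in>insert p I. of_nat (M b a) * x b) = of_nat (M p a) * x p + (\<Sum>b\<in>I. of_nat (M b a) * x b)"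
          for a and x :: "'a \<Rightarrow> rat" using insert.hyps False by simp
        have eqp: "(\<Sum>b\<in>insert p I. of_nat (M b p) * x b) = x p" for x :: "'a \<Rightarrow> rat"
          using eq[of p x] M0 M1 by simp
        show ?thesis
        proof (intro conjI allI impI)
          fix y :: "'a \<Rightarrow> rat"
          obtain x :: "'a \<Rightarrow> rat" where x: "\<forall>a\<in>I. (\<Sum>b\<in>I. of_nat (M b a) * x b) = y a - of_nat (M p a) * y p"
            using IH1[of "\<lambda>a. y a - of_nat (M p a) * y p"] by blast
          let ?x = "x(p := y p)"
          have "(\<Sum>b\<in>I. of_nat (M b a) * ?x b) = (\<Sum>b\<in>I. of_nat (M b a) * x b)" for a
            using False by (intro sum.cong) auto
          then have "\<forall>a\<in>insert p I. (\<Sum>b\<in>insert p I. of_nat (M b a) * ?x b) = y a"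
            using x eqp[of ?x] unfolding eq by auto
          then show "\<exists>x. \<forall>a\<in>insert p I. (\<Sum>b\<in>insert p I. of_nat (M b a) * x b) = y a" by blast
        next
          fix x :: "'a \<Rightarrow> rat" assume 0: "\<forall>a\<in>insert p I. (\<Sum>b\<in>insert p I. of_nat (M b a) * x b) = 0"
          then have "x p = 0" using eqp[of x] by simp
          moreover have "\<forall>a\<in>I. x a = 0" using IH2[of x] 0 \<open>x p = 0\<close> unfolding eq by simp
          ultimately show "\<forall>a\<in>insert p I. x a = 0" by simp
        qed
      qed
    qed
  qed simp
  with assms(2) show "\<exists>x :: 'a \<Rightarrow> rat. \<forall>a\<in>I. (\<Sum>b\<in>I. of_nat (M b a) * x b) = y a"
    and "(\<And>a. a \<in> I \<Longrightarrow> (\<Sum>b\<in>I. of_nat (M b a) * (x b :: rat)) = 0) \<Longrightarrow> a \<in> I \<Longrightarrow> x a = 0"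
    by blast+
qed

subsection \<open>Noncommutative Schur functions and the Pieri rule\<close>

lemma ribbon_outside: "v \<notin> comps (sum_list \<beta>) \<Longrightarrow> ribbon \<beta> v = 0"
  by (auto simp: ribbon_def coarsens_def comps_def)

text \<open>Justifies the definite description. For each degree and each coefficient
  \<open>w\<close> the condition is a separate rational system in the unknowns
  \<open>S \<alpha> w\<close>, with the unitriangular matrix \<open>dcoef\<close>.\<close>

lemma nc_schur_spec:
  "(\<forall>\<beta>. is_comp \<beta> \<longrightarrow>
      ribbon \<beta> = (\<lambda>w. \<Sum>\<alpha>\<in>comps (sum_list \<beta>). of_nat (dcoef \<alpha> \<beta>) * nc_schur \<alpha> w)) \<and>
    (\<forall>\<alpha>. \<not> is_comp \<alpha> \<longrightarrow> nc_schur \<alpha> = (\<lambda>_. 0))"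
proof -
  let ?P = "\<lambda>S. (\<forall>\<beta>. is_comp \<beta> \<longrightarrow>
      ribbon \<beta> = (\<lambda>w. \<Sum>\<alpha>\<in>comps (sum_list \<beta>). of_nat (dcoef \<alpha> \<beta>) * S \<alpha> w)) \<and>
    (\<forall>\<alpha>. \<not> is_comp \<alpha> \<longrightarrow> S \<alpha> = (\<lambda>_. 0))"
  have "\<exists>x. \<forall>\<beta>\<in>comps n. (\<Sum>\<alpha>\<in>comps n. of_nat (dcoef \<alpha> \<beta>) * x \<alpha>) = ribbon \<beta> w" for n w
    by (rule unitriangular_solve(1)[OF finite_comps unitriangular_dcoef])
  then obtain x where x: "\<And>n w \<beta>. \<beta> \<in> comps n \<Longrightarrow>
      (\<Sum>\<alpha>\<in>comps n. of_nat (dcoef \<alpha> \<beta>) * x n w \<alpha>) = ribbon \<beta> w" by metis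
  define S where "S \<alpha> w = (if is_comp \<alpha> then x (sum_list \<alpha>) w \<alpha> else 0)" for \<alpha> w
  have "?P S"
  proof (intro conjI allI impI ext)
    fix \<beta> w assume "is_comp \<beta>"
    then have "ribbon \<beta> w = (\<Sum>\<alpha>\<in>comps (sum_list \<beta>). of_nat (dcoef \<alpha> \<beta>) * x (sum_list \<beta>) w \<alpha>)"
      using x[of \<beta> "sum_list \<beta>" w] by (simp add: comps_def)
    also have "\<dots> = (\<Sum>\<alpha>\<in>comps (sum_list \<beta>). of_nat (dcoef \<alpha> \<beta>) * S \<alpha> w)"
      by (intro sum.cong) (auto simp: S_def comps_def)
    finally show "ribbon \<beta> w = (\<Sum>\<alpha>\<in>comps (sum_list \<beta>). of_nat (dcoef \<alpha> \<beta>) * S \<alpha> w)" .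
  qed (simp add: S_def)
  moreover have "T = S" if T: "?P T" for T
  proof (intro ext)
    fix \<alpha> w
    show "T \<alpha> w = S \<alpha> w"
    proof (cases "is_comp \<alpha>")
      case True
      have "T \<alpha> w - S \<alpha> w = 0"
      proof (rule unitriangular_solve(2)[OF finite_comps unitriangular_dcoef, where x = "\<lambda>\<gamma>. T \<gamma> w - S \<gamma> w"])
        show "\<alpha> \<in> comps (sum_list \<alpha>)" using True by (simp add: comps_def)
        fix \<beta> assume b: "\<beta> \<in> comps (sum_list \<alpha>)"
        have "ribbon \<beta> w = (\<Sum>\<gamma>\<in>comps (sum_list \<alpha>). of_nat (dcoef \<gamma> \<beta>) * R \<gamma> w)" if "?P R" for R
          using that b by (auto simp: comps_def dest!: conjunct1 spec[of _ \<beta>])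
        from this[OF T] this[OF \<open>?P S\<close>]
        show "(\<Sum>\<gamma>\<in>comps (sum_list \<alpha>). of_nat (dcoef \<gamma> \<beta>) * (T \<gamma> w - S \<gamma> w)) = 0"
          by (simp add: right_diff_distrib sum_subtractf)
      qed
      then show ?thesis by simp
    qed (use T in \<open>simp add: S_def\<close>)
  qed
  ultimately show ?thesis unfolding nc_schur_def by (rule theI[of ?P])
qed

lemma ribbon_nc_schur:
  "\<beta> \<in> comps n \<Longrightarrow> ribbon \<beta> w = (\<Sum>\<alpha>\<in>comps n. of_nat (dcoef \<alpha> \<beta>) * nc_schur \<alpha> w)"
  using nc_schur_spec by (auto simp: comps_def)

text \<open>The complete homogeneous function $\mathbf{h}_a$ is the sum of the ribbons coarser than \<open>a\<close>,
  hence its expansion in the noncommutative Schur functions has coefficients \<open>kostka\<close>.\<close>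

lemma hstrips_nc_schur:
  assumes "a \<in> comps n" "n \<le> N"
  shows "hstrips N a (\<lambda>\<gamma>. nc_schur \<gamma> v) [] = (if v = a then 1 else 0)"
proof -
  have "hstrips N a (\<lambda>\<gamma>. nc_schur \<gamma> v) [] = (\<Sum>\<beta> | \<beta> \<in> comps n \<and> psums \<beta> \<subseteq> psums a. ribbon \<beta> v)"
    unfolding sum_dcoef[OF assms, symmetric] by (intro sum.cong) (auto simp: ribbon_nc_schur)
  also have "\<dots> = (if v = a then 1 else 0)"
  proof (cases "v \<in> comps n")
    case True
    then show ?thesis using sum_ribbon assms(1) by simp
  next
    case False
    then have "v \<noteq> a" using assms by auto
    moreover have "(\<Sum>\<beta> | \<beta> \<in> comps n \<and> psums \<beta> \<subseteq> psums a. ribbon \<beta> v) = 0"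
      using False by (intro sum.neutral) (auto simp: comps_def intro!: ribbon_outside)
    ultimately show ?thesis by simp
  qed
  finally show ?thesis .
qed

lemma kostka_nc_schur:
  assumes "a \<in> comps n"
  shows "(\<Sum>\<gamma>\<in>comps n. of_nat (kostka \<gamma> a) * nc_schur \<gamma> v) = (if v = a then 1 else 0)"
  using hstrips_nc_schur[OF assms order_refl, of v] assms hstrips_kostka[of a n n]
  by (simp add: comps_def)

text \<open>Identities between functions of \<open>\<alpha>\<close> may thus be tested after pairing
  with every \<open>h_a\<close>.\<close>

lemma kostka_cancel:
  assumes "\<And>a. a \<in> comps n \<Longrightarrow> (\<Sum>\<gamma>\<in>comps n. of_nat (kostka \<gamma> a) * f \<gamma>) = (0 :: rat)" "\<alpha> \<in> comps n"
  shows "f \<alpha> = 0"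
  using unitriangular_solve(2)[OF finite_comps unitriangular_kostka] assms by blast

lemma nc_schur_outside:
  assumes "\<alpha> \<in> comps n" "v \<notin> comps n"
  shows "nc_schur \<alpha> v = 0"
  by (rule kostka_cancel[where n = n and f = "\<lambda>\<gamma>. nc_schur \<gamma> v"]) (use assms in \<open>auto simp: kostka_nc_schur\<close>)

text \<open>\<open>kostka_nc_schur\<close> is one half of the inversion of matrices; cancelling
  \<open>kostka\<close> yields the other half.\<close>

lemma nc_schur_dual:
  assumes "\<alpha> \<in> comps n" "\<beta> \<in> comps n"
  shows "(\<Sum>v\<in>comps n. nc_schur \<alpha> v * of_nat (kostka \<beta> v)) = (if \<alpha> = \<beta> then 1 else 0)"
proof -
  have "(\<Sum>v\<in>comps n. nc_schur \<alpha> v * of_nat (kostka \<beta> v)) - (if \<alpha> = \<beta> then 1 else 0) = 0"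
  proof (rule kostka_cancel[OF _ assms(1), where f = "\<lambda>\<gamma>.
      (\<Sum>v\<in>comps n. nc_schur \<gamma> v * of_nat (kostka \<beta> v)) - (if \<gamma> = \<beta> then 1 else 0)"])
    fix a assume a: "a \<in> comps n"
    have "(\<Sum>\<gamma>\<in>comps n. of_nat (kostka \<gamma> a) * (\<Sum>v\<in>comps n. nc_schur \<gamma> v * of_nat (kostka \<beta> v))) =
        (\<Sum>v\<in>comps n. (\<Sum>\<gamma>\<in>comps n. of_nat (kostka \<gamma> a) * nc_schur \<gamma> v) * of_nat (kostka \<beta> v))"
      unfolding sum_distrib_left sum_distrib_right by (subst sum.swap) (simp add: mult.assoc)
    also have "\<dots> = (\<Sum>v\<in>comps n. if v = a then of_nat (kostka \<beta> v) else 0)"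
      by (intro sum.cong) (simp_all add: kostka_nc_schur[OF a])
    also have "\<dots> = of_nat (kostka \<beta> a)" using a by (simp add: finite_comps)
    also have "of_nat (kostka \<beta> a) = (\<Sum>\<gamma>\<in>comps n. of_nat (kostka \<gamma> a) * (if \<gamma> = \<beta> then 1 else 0 :: rat))"
      using assms(2) by (simp add: finite_comps if_distrib cong: if_cong)
    finally show "(\<Sum>\<gamma>\<in>comps n. of_nat (kostka \<gamma> a) *
        ((\<Sum>v\<in>comps n. nc_schur \<gamma> v * of_nat (kostka \<beta> v)) - (if \<gamma> = \<beta> then 1 else 0))) = 0"
      by (simp only: right_diff_distrib sum_subtractf)
  qed
  then show ?thesis by simp
qed

text \<open>Pairing with \<open>kostka \<beta>\<close> extracts the coefficient at
  \<open>\<beta>\<close>.\<close>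

lemma nc_schur_independent:
  assumes "\<And>v. (\<Sum>\<beta>\<in>comps n. c \<beta> * nc_schur \<beta> v) = 0" "\<beta> \<in> comps n"
  shows "c \<beta> = 0"
proof -
  have "0 = (\<Sum>v\<in>comps n. (\<Sum>\<gamma>\<in>comps n. c \<gamma> * nc_schur \<gamma> v) * of_nat (kostka \<beta> v))"
    using assms by simp
  also have "\<dots> = (\<Sum>\<gamma>\<in>comps n. c \<gamma> * (\<Sum>v\<in>comps n. nc_schur \<gamma> v * of_nat (kostka \<beta> v)))"
    unfolding sum_distrib_left sum_distrib_right by (subst sum.swap) (simp add: mult.assoc)
  also have "\<dots> = (\<Sum>\<gamma>\<in>comps n. if \<gamma> = \<beta> then c \<gamma> else 0)"
    using assms(2) by (intro sum.cong) (simp_all add: nc_schur_dual)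
  also have "\<dots> = c \<beta>" using assms(2) by (simp add: finite_comps)
  finally show ?thesis by simp
qed

lemma nc_schur_expand:
  assumes "\<And>v. v \<notin> comps n \<Longrightarrow> p v = 0"
  shows "p w = (\<Sum>\<gamma>\<in>comps n. (\<Sum>v\<in>comps n. p v * of_nat (kostka \<gamma> v)) * nc_schur \<gamma> w)"
proof -
  have "(\<Sum>\<gamma>\<in>comps n. (\<Sum>v\<in>comps n. p v * of_nat (kostka \<gamma> v)) * nc_schur \<gamma> w) =
      (\<Sum>v\<in>comps n. p v * (\<Sum>\<gamma>\<in>comps n. of_nat (kostka \<gamma> v) * nc_schur \<gamma> w))"
    unfolding sum_distrib_left sum_distrib_right by (subst sum.swap) (simp add: mult.assoc)
  also have "\<dots> = (\<Sum>v\<in>comps n. if v = w then p v else 0)"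
    by (intro sum.cong) (auto simp: kostka_nc_schur)
  also have "\<dots> = p w" using assms[of w] by (auto simp: finite_comps)
  finally show ?thesis by simp
qed

section \<open>Commutation evaluated at the empty composition\<close>

lemma hstrips_zero: "hstrips N a (\<lambda>_. 0) = (\<lambda>_. 0)"
  by (induction a) (simp_all add: hstrip_zero)

lemma hstrips_append: "hstrips N (a @ b) f = hstrips N b (hstrips N a f)"
  by (induction a arbitrary: f) auto

lemma hstrips_snoc_1:
  assumes "1 \<le> N"
  shows "hstrips N (a @ [1]) f [] = hstrips N a f [1]"
proof -
  have "hstrip (Suc M) (Suc 0) g [] = g [1]" for M g
    by (induction M) (auto simp: pull_def add_cell_def)
  from this[of "N - 1"] show ?thesis using assms by (simp add: hstrips_append)
qed

text \<open>Only \<open>append_row 0\<close> acts on the empty composition, every other row needing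
  cells to remove. This matches \<open>hstrips_snoc_1\<close>.\<close>

lemma append_rows_Nil: "1 \<le> M \<Longrightarrow> append_rows M f [] = f [1]"
proof -
  assume "1 \<le> M"
  have "pull (append_row n) f [] = (if n = 0 then f [1] else 0)" for n
    by (cases n) (simp_all add: pull_def append_row_def)
  then show ?thesis using \<open>1 \<le> M\<close> by (simp add: append_rows_def)
qed

lemma dec_last_sum: "dec_last (Suc j) \<alpha> = Some \<beta> \<Longrightarrow> sum_list \<alpha> = Suc (sum_list \<beta>) \<and> (is_comp \<alpha> \<longrightarrow> is_comp \<beta>)"
  by (induction \<alpha> arbitrary: \<beta>) (auto split: option.splits if_splits)

lemma dec_chain_sum: "dec_chain n \<alpha> = Some \<beta> \<Longrightarrow> sum_list \<alpha> = sum_list \<beta> + n \<and> (is_comp \<alpha> \<longrightarrow> is_comp \<beta>)"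
proof (induction n arbitrary: \<alpha>)
  case (Suc n)
  then obtain \<gamma> where "dec_last (Suc n) \<alpha> = Some \<gamma>" "dec_chain n \<gamma> = Some \<beta>"
    by (auto simp: bind_eq_Some_conv)
  then show ?case using dec_last_sum[of n \<alpha> \<gamma>] Suc.IH[of \<gamma>] by auto
qed simp

lemma dec_chain_large: "sum_list \<alpha> < n \<Longrightarrow> dec_chain n \<alpha> = None"
  using dec_chain_sum[of n \<alpha>] by (cases "dec_chain n \<alpha>") auto

lemma append_row_comp:
  "append_row n \<alpha> = Some \<beta> \<Longrightarrow> sum_list \<beta> = Suc (sum_list \<alpha>) \<and> (is_comp \<alpha> \<longrightarrow> is_comp \<beta>) \<and> n \<le> sum_list \<alpha>"
  by (auto simp: append_row_def dest: dec_chain_sum)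

text \<open>Removes the boundary term: after the strip the size is still below \<open>N\<close>,
  while \<open>dec_chain N\<close> must take away N cells.\<close>

lemma hstrip_defect_zero:
  assumes "sum_list \<gamma> + k < N"
  shows "hstrip M k (pull (defect N) f) \<gamma> = 0"
  unfolding hstrip_eq
proof (rule sum.neutral, intro ballI)
  fix w assume w: "w \<in> strict_words M k"
  show "pull (add_cells w) (pull (defect N) f) \<gamma> = 0"
  proof (cases "add_cells w \<gamma>")
    case (Some \<delta>)
    then have "sum_list \<delta> < N" using assms w add_cells_Some_comp[OF Some] by (simp add: strict_words_def)
    then show ?thesis using Some by (simp add: pull_def defect_def dec_chain_large)
  qed (simp add: pull_def)
qed

lemma hstrips_cong:
  assumes "sum_list a \<le> N" "\<And>\<gamma>. \<gamma> \<in> comps (sum_list a) \<Longrightarrow> f \<gamma> = g \<gamma>"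
  shows "hstrips N a f [] = hstrips N a g []"
  using assms by (simp add: hstrips_kostka[OF refl])

lemma hstrips_append_rows:
  assumes "sum_list a \<le> N" "Suc N < M"
  shows "hstrips (Suc N) a (append_rows M f) [] = append_rows M (hstrips (Suc N) a f) []"
  using assms
proof (induction a arbitrary: f)
  case (Cons k a)
  \<comment> \<open>By \<open>hstrips_cong\<close> the remaining strips only see compositions of
    size \<open>sum_list a\<close>, and on these the boundary term vanishes.\<close>
  have "hstrip (Suc N) k (append_rows M f) \<gamma> = append_rows M (hstrip (Suc N) k f) \<gamma>"
    if "\<gamma> \<in> comps (sum_list a)" for \<gamma>
  proof (cases k)
    case 0
    have "hstrip (Suc N) 0 f = f" for f by (simp add: fun_eq_iff)
    then show ?thesis by (simp add: 0)
  next
    case (Suc k')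
    then have "sum_list \<gamma> + k' < N" using that Cons.prems by (simp add: comps_def)
    then show ?thesis using hstrip_append_rows[OF Cons.prems(2)] Suc by (simp add: hstrip_defect_zero)
  qed
  then have "hstrips (Suc N) a (hstrip (Suc N) k (append_rows M f)) [] =
      hstrips (Suc N) a (append_rows M (hstrip (Suc N) k f)) []"
    using Cons.prems by (intro hstrips_cong) auto
  then show ?case using Cons by simp
qed simp

section \<open>Right multiplication by a basis element\<close>

definition h_basis :: "nat list \<Rightarrow> nat list \<Rightarrow> rat" where
  "h_basis b = (\<lambda>w. if w = b then 1 else 0)"

lemma nsym_mult_h_basis_append: "nsym_mult p (h_basis b) (u @ b) = p u"
proof -
  have "(\<Sum>k\<le>length (u @ b). p (take k (u @ b)) * h_basis b (drop k (u @ b))) =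
      (\<Sum>k\<le>length (u @ b). if k = length u then p u else 0)"
  proof (rule sum.cong)
    fix k assume k: "k \<in> {..length (u @ b)}"
    show "p (take k (u @ b)) * h_basis b (drop k (u @ b)) = (if k = length u then p u else 0)"
    proof (cases "k = length u")
      case False
      have "drop k (u @ b) \<noteq> b"
      proof
        assume "drop k (u @ b) = b"
        then have "length u + length b - k = length b"
          using arg_cong[of _ _ length] by (metis length_drop length_append)
        then show False using k False by (simp only: atMost_iff length_append)
      qed
      then show ?thesis using False by (simp only: h_basis_def if_False mult_zero_right)
    qed (simp add: h_basis_def)
  qed simp
  then show ?thesis by (simp add: nsym_mult_def)
qed

lemma nsym_mult_h_basis_zero: "(\<And>u. w \<noteq> u @ b) \<Longrightarrow> nsym_mult p (h_basis b) w = 0"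
  unfolding nsym_mult_def h_basis_def by (rule sum.neutral) (metis append_take_drop_id mult_zero_right)

text \<open>Right multiplication by \<open>h_c\<close> only tests for the suffix \<open>c\<close>
  and removes it, so the claim compares two ways of removing \<open>b @ c\<close>.\<close>

lemma nsym_mult_h_basis_assoc:
  "nsym_mult (nsym_mult p (h_basis b)) (h_basis c) = nsym_mult p (h_basis (b @ c))"
proof (rule ext)
  fix w
  show "nsym_mult (nsym_mult p (h_basis b)) (h_basis c) w = nsym_mult p (h_basis (b @ c)) w"
  proof (cases "\<exists>u. w = u @ c")
    case True
    then obtain u where w: "w = u @ c" by blast
    show ?thesis
    proof (cases "\<exists>t. u = t @ b")
      case True
      then obtain t where "u = t @ b" by blast
      then have "w = (t @ b) @ c" "w = t @ (b @ c)" using w by simp_all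
      then show ?thesis using nsym_mult_h_basis_append by metis
    next
      case False
      then show ?thesis using w by (simp add: nsym_mult_h_basis_append nsym_mult_h_basis_zero)
    qed
  next
    case False
    then have "w \<noteq> u @ c" "w \<noteq> u @ b @ c" for u by (metis append.assoc)+
    then show ?thesis by (simp add: nsym_mult_h_basis_zero)
  qed
qed

lemma nsym_mult_sum_left: "nsym_mult (\<lambda>w. \<Sum>i\<in>I. c i * p i w) q w = (\<Sum>i\<in>I. c i * nsym_mult (p i) q w)"
  unfolding nsym_mult_def sum_distrib_right sum_distrib_left by (subst sum.swap) (simp add: mult.assoc)

lemma nsym_mult_sum_right: "nsym_mult q (\<lambda>w. \<Sum>i\<in>I. c i * p i w) w = (\<Sum>i\<in>I. c i * nsym_mult q (p i) w)"
  unfolding nsym_mult_def sum_distrib_left by (subst sum.swap) (simp add: mult_ac)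

text \<open>The Pieri rule for $\mathbf{s}_\alpha \cdot \mathbf{h}_1$. Both sides are functions of \<open>\<alpha>\<close>;
  by \<open>kostka_cancel\<close> it suffices to compare them after applying each \<open>hstrips\<close>, where the claim
  is the commutation of \<open>append_rows\<close> with horizontal strips.\<close>

lemma nc_schur_pieri:
  assumes "\<alpha> \<in> comps n" "Suc (Suc n) < M"
  shows "nsym_mult (nc_schur \<alpha>) (h_basis [1]) v = append_rows M (\<lambda>\<gamma>. nc_schur \<gamma> v) \<alpha>"
proof -
  let ?F = "\<lambda>\<gamma>. nsym_mult (nc_schur \<gamma>) (h_basis [1]) v"
  let ?G = "append_rows M (\<lambda>\<gamma>. nc_schur \<gamma> v)"
  \<comment> \<open>There are \<open>Suc ?N = n + 2\<close> columns, enough for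
    \<open>a @ [1]\<close>; the hypothesis on \<open>M\<close> is exactly
    \<open>Suc ?N < M\<close>.\<close>
  let ?N = "Suc n"
  have F: "hstrips (Suc ?N) a ?F [] = (if v = a @ [1] then 1 else 0)" if a: "a \<in> comps n" for a
  proof (cases "\<exists>u. v = u @ [1]")
    case True
    then obtain u where v: "v = u @ [1]" by blast
    then show ?thesis using hstrips_nc_schur[OF a, of "Suc ?N" u] by (simp add: nsym_mult_h_basis_append)
  next
    case False
    then have "?F = (\<lambda>_. 0)" by (auto intro: nsym_mult_h_basis_zero)
    then have "hstrips (Suc ?N) a ?F [] = 0" by (simp only: hstrips_zero)
    then show ?thesis using False by auto
  qed
  have G: "hstrips (Suc ?N) a ?G [] = (if v = a @ [1] then 1 else 0)" if a: "a \<in> comps n" for a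
  proof -
    have "sum_list a \<le> ?N" "a @ [1] \<in> comps (Suc n)" using a by (auto simp: comps_def)
    then have "hstrips (Suc ?N) a ?G [] = append_rows M (hstrips (Suc ?N) a (\<lambda>\<gamma>. nc_schur \<gamma> v)) []"
      using assms by (intro hstrips_append_rows) auto
    \<comment> \<open>The appended row and a last strip of size 1 have the same effect on the empty
      composition.\<close>
    also have "\<dots> = hstrips (Suc ?N) (a @ [1]) (\<lambda>\<gamma>. nc_schur \<gamma> v) []"
      using assms by (simp add: append_rows_Nil hstrips_snoc_1 del: One_nat_def)
    also have "\<dots> = (if v = a @ [1] then 1 else 0)"
      by (rule hstrips_nc_schur[OF \<open>a @ [1] \<in> comps (Suc n)\<close>]) simp
    finally show ?thesis .
  qed
  have "?F \<alpha> - ?G \<alpha> = 0"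
  proof (rule kostka_cancel[OF _ assms(1), where f = "\<lambda>\<gamma>. ?F \<gamma> - ?G \<gamma>"])
    fix a assume a: "a \<in> comps n"
    have "(\<Sum>\<gamma>\<in>comps n. of_nat (kostka \<gamma> a) * ?F \<gamma>) = (\<Sum>\<gamma>\<in>comps n. of_nat (kostka \<gamma> a) * ?G \<gamma>)"
      using F[OF a] G[OF a] a hstrips_kostka[of a n "Suc ?N" ?F] hstrips_kostka[of a n "Suc ?N" ?G]
      by (simp add: comps_def)
    then show "(\<Sum>\<gamma>\<in>comps n. of_nat (kostka \<gamma> a) * (?F \<gamma> - ?G \<gamma>)) = 0"
      by (simp only: right_diff_distrib sum_subtractf)
  qed
  then show ?thesis by simp
qed

subsection \<open>Chains\<close>

lemma rcover_iff: "rcover \<alpha> \<gamma> \<longleftrightarrow> (\<exists>n. append_row n \<alpha> = Some \<gamma>)"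
  unfolding rcover_def by (metis One_nat_def Suc_le_D le_add1 plus_1_eq_Suc uop_Suc)

lemma rcover_comp: "rcover \<alpha> \<gamma> \<Longrightarrow> sum_list \<gamma> = Suc (sum_list \<alpha>) \<and> (is_comp \<alpha> \<longrightarrow> is_comp \<gamma>)"
  by (auto simp: rcover_iff dest: append_row_comp)

lemma append_row_inj: "append_row n \<alpha> = Some \<gamma> \<Longrightarrow> append_row m \<alpha> = Some \<gamma> \<Longrightarrow> n = m"
  by (auto simp: append_row_def)

text \<open>The last part of a cover determines \<open>n\<close>, so distinct rows give distinct
  covers. A row \<open>n\<close> needs \<open>n\<close> cells to remove, whence the bound
  \<open>M\<close> suffices.\<close>

lemma bij_rcover:
  assumes "sum_list \<alpha> < M"
  shows "bij_betw (\<lambda>n. the (append_row n \<alpha>)) {n. n < M \<and> append_row n \<alpha> \<noteq> None} {\<gamma>. rcover \<alpha> \<gamma>}"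
  unfolding bij_betw_def
proof
  show "inj_on (\<lambda>n. the (append_row n \<alpha>)) {n. n < M \<and> append_row n \<alpha> \<noteq> None}"
    by (auto simp: inj_on_def intro: append_row_inj)
  show "(\<lambda>n. the (append_row n \<alpha>)) ` {n. n < M \<and> append_row n \<alpha> \<noteq> None} = {\<gamma>. rcover \<alpha> \<gamma>}"
  proof (intro equalityI subsetI)
    fix \<gamma> assume "\<gamma> \<in> {\<gamma>. rcover \<alpha> \<gamma>}"
    then obtain n where n: "append_row n \<alpha> = Some \<gamma>" by (auto simp: rcover_iff)
    then have "n < M" using append_row_comp[OF n] assms by simp
    then show "\<gamma> \<in> (\<lambda>n. the (append_row n \<alpha>)) ` {n. n < M \<and> append_row n \<alpha> \<noteq> None}"
      using n by (intro image_eqI[of _ _ n]) auto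
  qed (auto simp: rcover_iff)
qed

lemma finite_rcover: "finite {\<gamma>. rcover \<alpha> \<gamma>}"
  using bij_betw_finite[OF bij_rcover[of \<alpha> "Suc (sum_list \<alpha>)"]] by simp

lemma append_rows_rcover:
  assumes "sum_list \<alpha> < M"
  shows "append_rows M f \<alpha> = (\<Sum>\<gamma> | rcover \<alpha> \<gamma>. f \<gamma>)"
proof -
  have "append_rows M f \<alpha> = (\<Sum>n | n < M \<and> append_row n \<alpha> \<noteq> None. f (the (append_row n \<alpha>)))"
    unfolding append_rows_def by (rule sum.mono_neutral_cong_right) (auto simp: pull_def)
  also have "\<dots> = (\<Sum>\<gamma> | rcover \<alpha> \<gamma>. f \<gamma>)"
    by (rule sum.reindex_bij_betw[OF bij_rcover[OF assms]])
  finally show ?thesis .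
qed

section \<open>Counting maximal chains\<close>

lemma max_chains_eq:
  "max_chains \<alpha> \<beta> = {cs. cs \<noteq> [] \<and> hd cs = \<alpha> \<and> last cs = \<beta> \<and> successively rcover cs}"
  by (simp add: max_chains_def successively_conv_nth)

text \<open>The poset is graded by size; in particular a chain without increase in size is a single
  point.\<close>

lemma max_chains_length: "cs \<in> max_chains \<alpha> \<beta> \<Longrightarrow> Suc (sum_list \<beta>) = sum_list \<alpha> + length cs"
  unfolding max_chains_eq
proof (induction cs arbitrary: \<alpha>)
  case (Cons x cs)
  then show ?case by (cases cs) (auto dest!: rcover_comp)
qed simp

lemma max_chains_trivial:
  assumes "sum_list \<beta> \<le> sum_list \<alpha>"
  shows "max_chains \<alpha> \<beta> = (if \<alpha> = \<beta> then {[\<alpha>]} else {})"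
proof -
  have "cs = [\<alpha>] \<and> \<alpha> = \<beta>" if "cs \<in> max_chains \<alpha> \<beta>" for cs
  proof -
    have "length cs \<le> 1" "cs \<noteq> []" "hd cs = \<alpha>" "last cs = \<beta>"
      using max_chains_length[OF that] that assms by (auto simp: max_chains_eq)
    then show ?thesis by (cases cs) auto
  qed
  moreover have "[\<alpha>] \<in> max_chains \<alpha> \<alpha>" by (simp add: max_chains_eq)
  ultimately show ?thesis by auto
qed

text \<open>Distinct ends exclude the one-element chain, so there is a first step to split
  off.\<close>

lemma max_chains_step:
  assumes "\<alpha> \<noteq> \<beta>"
  shows "max_chains \<alpha> \<beta> = (#) \<alpha> ` (\<Union>\<gamma>\<in>{\<gamma>. rcover \<alpha> \<gamma>}. max_chains \<gamma> \<beta>)"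
proof (intro equalityI subsetI)
  fix cs assume "cs \<in> max_chains \<alpha> \<beta>"
  then obtain cs' where cs: "cs = \<alpha> # cs'" "last cs = \<beta>" "successively rcover cs"
    by (cases cs) (auto simp: max_chains_eq)
  then obtain \<gamma> t where "cs' = \<gamma> # t" using assms by (cases cs') auto
  then show "cs \<in> (#) \<alpha> ` (\<Union>\<gamma>\<in>{\<gamma>. rcover \<alpha> \<gamma>}. max_chains \<gamma> \<beta>)"
    using cs by (auto simp: max_chains_eq)
next
  fix cs assume "cs \<in> (#) \<alpha> ` (\<Union>\<gamma>\<in>{\<gamma>. rcover \<alpha> \<gamma>}. max_chains \<gamma> \<beta>)"
  then obtain \<gamma> t where "rcover \<alpha> \<gamma>" "cs = \<alpha> # t" "t \<in> max_chains \<gamma> \<beta>" by auto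
  then show "cs \<in> max_chains \<alpha> \<beta>" by (cases t) (auto simp: max_chains_eq)
qed

lemma finite_max_chains: "finite (max_chains \<alpha> \<beta>)"
proof (induction "sum_list \<beta> - sum_list \<alpha>" arbitrary: \<alpha>)
  case 0
  then show ?case by (simp add: max_chains_trivial)
next
  case (Suc n)
  have "finite (max_chains \<gamma> \<beta>)" if "rcover \<alpha> \<gamma>" for \<gamma>
    using Suc.hyps(1)[of \<gamma>] Suc.hyps(2) rcover_comp[OF that] by simp
  moreover have "\<alpha> \<noteq> \<beta>" using Suc.hyps(2) by auto
  ultimately show ?case using finite_rcover by (simp add: max_chains_step)
qed

lemma fchains_eq_size: "sum_list \<beta> \<le> sum_list \<alpha> \<Longrightarrow> fchains \<alpha> \<beta> = (if \<alpha> = \<beta> then 1 else 0)"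
  by (simp add: fchains_def max_chains_trivial)

lemma fchains_step:
  assumes "\<alpha> \<noteq> \<beta>"
  shows "fchains \<alpha> \<beta> = (\<Sum>\<gamma> | rcover \<alpha> \<gamma>. fchains \<gamma> \<beta>)"
proof -
  have "fchains \<alpha> \<beta> = card (\<Union>\<gamma>\<in>{\<gamma>. rcover \<alpha> \<gamma>}. max_chains \<gamma> \<beta>)"
    unfolding fchains_def max_chains_step[OF assms] by (rule card_image) simp
  also have "\<dots> = (\<Sum>\<gamma> | rcover \<alpha> \<gamma>. fchains \<gamma> \<beta>)"
    unfolding fchains_def
    by (rule card_UN_disjoint) (auto simp: finite_rcover finite_max_chains, auto simp: max_chains_eq)
  finally show ?thesis .
qed

section \<open>Powers of h_1 and the structure coefficients\<close>

text \<open>The leftmost factor \<open>h_1\<close> is multiplied first and accounts for the first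
  step of a chain; the remaining factors are the induction hypothesis at each cover.\<close>

lemma nc_schur_h_ones:
  "\<alpha> \<in> comps m \<Longrightarrow> nsym_mult (nc_schur \<alpha>) (h_basis (replicate n 1)) v =
    (\<Sum>\<beta>\<in>comps (m + n). of_nat (fchains \<alpha> \<beta>) * nc_schur \<beta> v)"
proof (induction n arbitrary: \<alpha> m)
  case 0
  have "(\<Sum>\<beta>\<in>comps m. of_nat (fchains \<alpha> \<beta>) * nc_schur \<beta> v) = (\<Sum>\<beta>\<in>comps m. if \<alpha> = \<beta> then nc_schur \<beta> v else 0)"
    using 0 by (intro sum.cong) (auto simp: comps_def fchains_eq_size)
  also have "\<dots> = nc_schur \<alpha> v" using 0 by (simp add: finite_comps)
  finally show ?case using nsym_mult_h_basis_append[of "nc_schur \<alpha>" "[]" v] by simp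
next
  case (Suc n)
  have 1: "nsym_mult (nc_schur \<alpha>) (h_basis [1]) = (\<lambda>w. \<Sum>\<gamma> | rcover \<alpha> \<gamma>. 1 * nc_schur \<gamma> w)"
  proof (rule ext)
    fix w
    \<comment> \<open>\<open>lessI\<close> below instantiates \<open>M\<close> with
      \<open>Suc (Suc (Suc m))\<close>; the same bound makes the rows exhaust all covers.\<close>
    have "sum_list \<alpha> < Suc (Suc (Suc m))" using Suc.prems by (simp add: comps_def)
    then show "nsym_mult (nc_schur \<alpha>) (h_basis [1]) w = (\<Sum>\<gamma> | rcover \<alpha> \<gamma>. 1 * nc_schur \<gamma> w)"
      unfolding nc_schur_pieri[OF Suc.prems lessI] by (simp add: append_rows_rcover)
  qed
  have "nsym_mult (nc_schur \<alpha>) (h_basis (replicate (Suc n) 1)) v =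
      nsym_mult (nsym_mult (nc_schur \<alpha>) (h_basis [1])) (h_basis (replicate n 1)) v"
    unfolding nsym_mult_h_basis_assoc by simp
  also have "\<dots> = (\<Sum>\<gamma> | rcover \<alpha> \<gamma>. nsym_mult (nc_schur \<gamma>) (h_basis (replicate n 1)) v)"
    unfolding 1 nsym_mult_sum_left by simp
  also have "\<dots> = (\<Sum>\<gamma> | rcover \<alpha> \<gamma>. \<Sum>\<beta>\<in>comps (m + Suc n). of_nat (fchains \<gamma> \<beta>) * nc_schur \<beta> v)"
  proof (rule sum.cong[OF refl])
    fix \<gamma> assume "\<gamma> \<in> {\<gamma>. rcover \<alpha> \<gamma>}"
    then have "\<gamma> \<in> comps (Suc m)" using rcover_comp[of \<alpha> \<gamma>] Suc.prems by (simp add: comps_def)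
    then show "nsym_mult (nc_schur \<gamma>) (h_basis (replicate n 1)) v =
        (\<Sum>\<beta>\<in>comps (m + Suc n). of_nat (fchains \<gamma> \<beta>) * nc_schur \<beta> v)"
      using Suc.IH[of \<gamma> "Suc m"] by simp
  qed
  also have "\<dots> = (\<Sum>\<beta>\<in>comps (m + Suc n). of_nat (\<Sum>\<gamma> | rcover \<alpha> \<gamma>. fchains \<gamma> \<beta>) * nc_schur \<beta> v)"
    by (subst sum.swap) (simp add: sum_distrib_right)
  also have "\<dots> = (\<Sum>\<beta>\<in>comps (m + Suc n). of_nat (fchains \<alpha> \<beta>) * nc_schur \<beta> v)"
  proof (rule sum.cong[OF refl])
    fix \<beta> assume "\<beta> \<in> comps (m + Suc n)"
    then have "\<alpha> \<noteq> \<beta>" using Suc.prems by (auto simp: comps_def)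
    then show "of_nat (\<Sum>\<gamma> | rcover \<alpha> \<gamma>. fchains \<gamma> \<beta>) * nc_schur \<beta> v = of_nat (fchains \<alpha> \<beta>) * nc_schur \<beta> v"
      using fchains_step[of \<alpha> \<beta>] by simp
  qed
  finally show ?case .
qed

lemma h_ones: "h_basis (replicate n 1) w = (\<Sum>\<gamma>\<in>comps n. of_nat (fchains [] \<gamma>) * nc_schur \<gamma> w)"
proof -
  have nil: "[] \<in> comps 0" by (simp add: comps_def)
  \<comment> \<open>For \<open>a = []\<close> no strip is applied, so
    \<open>hstrips_nc_schur\<close> evaluates \<open>nc_schur []\<close> itself.\<close>
  have s: "nc_schur [] = h_basis []"
    using hstrips_nc_schur[OF nil order_refl] by (auto simp: h_basis_def)
  have "nsym_mult (h_basis []) (h_basis b) w = h_basis b w" for b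
  proof (cases "\<exists>u. w = u @ b")
    case True
    then obtain u where "w = u @ b" by blast
    then show ?thesis by (simp add: nsym_mult_h_basis_append) (simp add: h_basis_def)
  next
    case False
    moreover from False have "w \<noteq> b" by (metis append_Nil)
    ultimately show ?thesis by (simp add: nsym_mult_h_basis_zero) (simp add: h_basis_def)
  qed
  then show ?thesis using nc_schur_h_ones[OF nil, of n w] by (simp add: s)
qed

text \<open>Justifies the definite description: the product is homogeneous of degree
  \<open>m + n\<close> and therefore expands, and linear independence makes the coefficients
  unique.\<close>

lemma lr_coef_spec:
  assumes "\<alpha> \<in> comps m" "\<gamma> \<in> comps n"
  shows "nsym_mult (nc_schur \<alpha>) (nc_schur \<gamma>) w = (\<Sum>\<beta>\<in>comps (m + n). lr_coef \<alpha> \<gamma> \<beta> * nc_schur \<beta> w)"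
    and "\<beta> \<notin> comps (m + n) \<Longrightarrow> lr_coef \<alpha> \<gamma> \<beta> = 0"
proof -
  let ?p = "nsym_mult (nc_schur \<alpha>) (nc_schur \<gamma>)"
  let ?P = "\<lambda>c. ?p = (\<lambda>w. \<Sum>\<beta>\<in>comps (m + n). c \<beta> * nc_schur \<beta> w) \<and> (\<forall>\<beta>. \<beta> \<notin> comps (m + n) \<longrightarrow> c \<beta> = 0)"
  have mn: "sum_list \<alpha> = m" "sum_list \<gamma> = n" using assms by (auto simp: comps_def)
  have outside: "?p v = 0" if "v \<notin> comps (m + n)" for v
    unfolding nsym_mult_def
  proof (rule sum.neutral, intro ballI)
    fix k
    have "take k v \<notin> comps m \<or> drop k v \<notin> comps n"
    proof (rule ccontr)
      assume "\<not> (take k v \<notin> comps m \<or> drop k v \<notin> comps n)"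
      then have "take k v @ drop k v \<in> comps (m + n)"
        unfolding comps_def by (simp only: mem_Collect_eq is_comp_append sum_list_append) simp
      then show False using that by simp
    qed
    then show "nc_schur \<alpha> (take k v) * nc_schur \<gamma> (drop k v) = 0"
      using nc_schur_outside assms by auto
  qed
  define c where "c \<beta> = (if \<beta> \<in> comps (m + n) then \<Sum>v\<in>comps (m + n). ?p v * of_nat (kostka \<beta> v) else 0)" for \<beta>
  have "?P c"
  proof (intro conjI ext allI impI)
    fix w
    have "?p w = (\<Sum>\<beta>\<in>comps (m + n). (\<Sum>v\<in>comps (m + n). ?p v * of_nat (kostka \<beta> v)) * nc_schur \<beta> w)"
      by (rule nc_schur_expand[OF outside])
    also have "\<dots> = (\<Sum>\<beta>\<in>comps (m + n). c \<beta> * nc_schur \<beta> w)"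
      by (intro sum.cong) (simp_all add: c_def)
    finally show "?p w = (\<Sum>\<beta>\<in>comps (m + n). c \<beta> * nc_schur \<beta> w)" .
  qed (simp add: c_def)
  moreover have "c' = c" if "?P c'" for c'
  proof (rule ext)
    fix \<beta>
    show "c' \<beta> = c \<beta>"
    proof (cases "\<beta> \<in> comps (m + n)")
      case True
      have "(\<Sum>\<beta>\<in>comps (m + n). (c' \<beta> - c \<beta>) * nc_schur \<beta> v) = 0" for v
        using fun_cong[OF conjunct1[OF that], of v] fun_cong[OF conjunct1[OF \<open>?P c\<close>], of v]
        by (simp add: left_diff_distrib sum_subtractf)
      from nc_schur_independent[where n = "m + n" and c = "\<lambda>\<beta>. c' \<beta> - c \<beta>", OF this True] show ?thesis by simp
    qed (use that in \<open>simp add: c_def\<close>)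
  qed
  ultimately have "?P (THE c. ?P c)" by (rule theI[of ?P])
  then have *: "?P (lr_coef \<alpha> \<gamma>)" unfolding lr_coef_def mn .
  show "?p w = (\<Sum>\<beta>\<in>comps (m + n). lr_coef \<alpha> \<gamma> \<beta> * nc_schur \<beta> w)"
    by (rule fun_cong[OF conjunct1[OF *]])
  show "\<beta> \<notin> comps (m + n) \<Longrightarrow> lr_coef \<alpha> \<gamma> \<beta> = 0" using * by blast
qed

theorem theorem9p4:
  fixes \<alpha> \<beta> :: "nat list"
  assumes "is_comp \<alpha>" and "is_comp \<beta>"
  shows "of_nat (fchains \<alpha> \<beta>) =
    (\<Sum>\<gamma>\<in>comps (sum_list \<beta> - sum_list \<alpha>). lr_coef \<alpha> \<gamma> \<beta> * of_nat (fchains [] \<gamma>))"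
proof (cases "sum_list \<alpha> \<le> sum_list \<beta>")
  case True
  define m n where "m = sum_list \<alpha>" and "n = sum_list \<beta> - sum_list \<alpha>"
  have a: "\<alpha> \<in> comps m" and b: "\<beta> \<in> comps (m + n)"
    using assms True by (auto simp: comps_def m_def n_def)
  let ?c = "\<lambda>\<beta>. \<Sum>\<gamma>\<in>comps n. lr_coef \<alpha> \<gamma> \<beta> * of_nat (fchains [] \<gamma>)"
  have "(\<Sum>\<beta>\<in>comps (m + n). (of_nat (fchains \<alpha> \<beta>) - ?c \<beta>) * nc_schur \<beta> v) = 0" for v
  proof -
    have "(\<Sum>\<beta>\<in>comps (m + n). of_nat (fchains \<alpha> \<beta>) * nc_schur \<beta> v) =
        nsym_mult (nc_schur \<alpha>) (\<lambda>w. \<Sum>\<gamma>\<in>comps n. of_nat (fchains [] \<gamma>) * nc_schur \<gamma> w) v"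
      using nc_schur_h_ones[OF a, of n v] unfolding h_ones[abs_def] by simp
    also have "\<dots> = (\<Sum>\<gamma>\<in>comps n. of_nat (fchains [] \<gamma>) *
        (\<Sum>\<beta>\<in>comps (m + n). lr_coef \<alpha> \<gamma> \<beta> * nc_schur \<beta> v))"
      unfolding nsym_mult_sum_right by (intro sum.cong) (simp_all add: lr_coef_spec(1)[OF a])
    also have "\<dots> = (\<Sum>\<beta>\<in>comps (m + n). ?c \<beta> * nc_schur \<beta> v)"
      unfolding sum_distrib_left sum_distrib_right by (subst sum.swap) (simp add: mult_ac)
    finally show ?thesis by (simp add: left_diff_distrib sum_subtractf)
  qed
  from nc_schur_independent[where n = "m + n" and c = "\<lambda>\<beta>. of_nat (fchains \<alpha> \<beta>) - ?c \<beta>", OF this b]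
  show ?thesis by (simp add: n_def)
next
  case False
  \<comment> \<open>Truncated subtraction leaves degree 0, so only the empty composition is summed
    over. Its coefficient vanishes because \<open>\<beta>\<close> is too small for the degree of the
    product, and there is no chain downwards.\<close>
  have "\<gamma> \<in> comps 0 \<longleftrightarrow> \<gamma> = []" for \<gamma> by (cases \<gamma>) (auto simp: comps_def)
  then have "comps 0 = {[]}" by auto
  moreover have "lr_coef \<alpha> [] \<beta> = 0"
    using lr_coef_spec(2)[of \<alpha> "sum_list \<alpha>" "[]" 0 \<beta>] False assms by (simp add: comps_def)
  ultimately show ?thesis using False by (auto simp: fchains_eq_size)
qed

end
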